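(* If $U\subseteq\mathbb{M}^1$ is a free domain and $f$ is a freely holomorphic function on $U$, then $f(x)=f_1^{\wedge}(x)$ for all $x\in U$. Moreover $f(x)$ belongs to the algebra generated by $x$ and the identity matrix of the same size as $x$.
   Context: $\mathbb{M}_n$ is the algebra of $n\times n$ complex matrices and $\mathbb{M}^1=\bigcup_{n\ge1}\mathbb{M}_n$ (disjoint union). An *nc-set* is a subset of $\mathbb{M}^1$ closed under direct sums. A function $f:D\to\mathbb{M}^1$ is *graded* if $f(x)\in\mathbb{M}_n$ whenever $x\in D\cap\mathbb{M}_n$. An *nc-function* is a graded function $f$ on an nc-set $D$ such that $f(x\oplus y)=f(x)\oplus f(y)$, and $f(s^{-1}xs)=s^{-1}f(x)s$ whenever $x\in D\cap\mathbb{M}_n$, $s\in\mathbb{M}_n$ is invertible and $s^{-1}xs\in D$. The *free topology* on $\mathbb{M}^1$ has as base the sets $B_\delta=\{x:\|[\delta_{ij}(x)]\|<1\}$, where $\delta$ is a (rectangular) matrix of polynomials in one variable; freely open sets are called free domains. A graded function $f$ on a free domain $D$ is *freely holomorphic* if every $x\in D$ has a freely open neighborhood $V\subseteq D$ that is an nc-set on which $f$ is an nc-function, and a free neighborhood on which $f$ is bounded (in operator norm). For a free domain $U\subseteq\mathbb{M}^1$, $U_1=U\cap\mathbb{M}_1$, regarded as a subset of $\mathbb{C}$, and $f_1(z)=f([z])$ for $z\in U_1$. (The spectrum of every $x\in U$ is contained in $U_1$ and $f_1$ is holomorphic on $U_1$.) For $g$ holomorphic on a neighborhood of the spectrum of a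 matrix $x$, $g^{\wedge}(x)$ denotes the matrix obtained from the Riesz (holomorphic) functional calculus. *)

theory Defs
  imports
    "HOL-Complex_Analysis.Complex_Analysis"
    "Jordan_Normal_Form.Spectral_Radius"
    "Jordan_Normal_Form.Gauss_Jordan_Elimination"
begin

unbundle no vec_syntax
hide_const (open) Finite_Cartesian_Product.mat Finite_Cartesian_Product.vec
hide_const (open) Finite_Cartesian_Product.row Finite_Cartesian_Product.column

definition nc_universe :: "complex mat set" where
  "nc_universe = (\<Union>n\<in>{1..}. carrier_mat n n)"

definition nc_sum :: "complex mat \<Rightarrow> complex mat \<Rightarrow> complex mat" (infixr "\<oplus>\<^sub>d" 65) where
  "x \<oplus>\<^sub>d y = four_block_mat x (0\<^sub>m (dim_row x) (dim_col y)) (0\<^sub>m (dim_row y) (dim_col x)) y"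

definition nc_set :: "complex mat set \<Rightarrow> bool" where
  "nc_set D \<longleftrightarrow> D \<subseteq> nc_universe \<and> (\<forall>x\<in>D. \<forall>y\<in>D. x \<oplus>\<^sub>d y \<in> D)"

definition graded_on :: "complex mat set \<Rightarrow> (complex mat \<Rightarrow> complex mat) \<Rightarrow> bool" where
  "graded_on D f \<longleftrightarrow> (\<forall>n\<ge>1. \<forall>x \<in> D \<inter> carrier_mat n n. f x \<in> carrier_mat n n)"

definition nc_function_on :: "complex mat set \<Rightarrow> (complex mat \<Rightarrow> complex mat) \<Rightarrow> bool" where
  "nc_function_on D f \<longleftrightarrow> nc_set D \<and> graded_on D f \<and>
     (\<forall>x\<in>D. \<forall>y\<in>D. f (x \<oplus>\<^sub>d y) = f x \<oplus>\<^sub>d f y) \<and>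
     (\<forall>n\<ge>1. \<forall>x \<in> D \<inter> carrier_mat n n. \<forall>s \<in> carrier_mat n n. \<forall>t \<in> carrier_mat n n.
        inverts_mat s t \<and> inverts_mat t s \<and> t * x * s \<in> D \<longrightarrow> f (t * x * s) = t * f x * s)"

definition euclid_norm :: "complex vec \<Rightarrow> real" where
  "euclid_norm v = L2_set (\<lambda>i. cmod (v $ i)) {..<dim_vec v}"

definition op_norm :: "complex mat \<Rightarrow> real" where
  "op_norm A = Sup {euclid_norm (A *\<^sub>v v) | v. v \<in> carrier_vec (dim_col A) \<and> euclid_norm v \<le> 1}"

definition poly_at :: "complex poly \<Rightarrow> complex mat \<Rightarrow> complex mat" where
  "poly_at p x = mat (dim_row x) (dim_row x)
     (\<lambda>(i, j). \<Sum>k\<le>degree p. coeff p k * (x ^\<^sub>m k) $$ (i, j))"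

text \<open>The block matrix whose block in position \<open>(i, j)\<close> is the value of the polynomial
  \<open>\<delta> $$ (i, j)\<close> at \<open>x\<close>.\<close>

definition poly_mat_at :: "complex poly mat \<Rightarrow> complex mat \<Rightarrow> complex mat" where
  "poly_mat_at \<delta> x = (let n = dim_row x in
     mat (dim_row \<delta> * n) (dim_col \<delta> * n)
       (\<lambda>(i, j). poly_at (\<delta> $$ (i div n, j div n)) x $$ (i mod n, j mod n)))"

definition free_ball :: "complex poly mat \<Rightarrow> complex mat set" where
  "free_ball \<delta> = {x \<in> nc_universe. op_norm (poly_mat_at \<delta> x) < 1}"

definition freely_open :: "complex mat set \<Rightarrow> bool" where
  "freely_open U \<longleftrightarrow> (arbitrary union_of (\<lambda>S. S \<in> range free_ball)) U"

definition freely_holomorphic_on :: "complex mat set \<Rightarrow> (complex mat \<Rightarrow> complex mat) \<Rightarrow> bool" where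
  "freely_holomorphic_on D f \<longleftrightarrow> freely_open D \<and> graded_on D f \<and>
     (\<forall>x\<in>D. (\<exists>V. freely_open V \<and> x \<in> V \<and> V \<subseteq> D \<and> nc_function_on V f) \<and>
            (\<exists>W. freely_open W \<and> x \<in> W \<and> W \<subseteq> D \<and> (\<exists>C. \<forall>y\<in>W. op_norm (f y) \<le> C)))"

definition level1 :: "complex mat set \<Rightarrow> complex set" where
  "level1 U = {z. mat 1 1 (\<lambda>_. z) \<in> U}"

definition fun1 :: "(complex mat \<Rightarrow> complex mat) \<Rightarrow> complex \<Rightarrow> complex" where
  "fun1 f z = f (mat 1 1 (\<lambda>_. z)) $$ (0, 0)"

text \<open>A contour is a finite family of closed paths, which need not lie in a single component of
  \<open>\<Omega>\<close>; it surrounds \<open>K\<close> in \<open>\<Omega>\<close> if its total index is \<open>1\<close> on \<open>K\<close> and \<open>0\<close> off \<open>\<Omega>\<close>.\<close>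

definition surrounds_in :: "(real \<Rightarrow> complex) list \<Rightarrow> complex set \<Rightarrow> complex set \<Rightarrow> bool" where
  "surrounds_in \<Gamma> K \<Omega> \<longleftrightarrow>
     (\<forall>\<gamma>\<in>set \<Gamma>. valid_path \<gamma> \<and> pathfinish \<gamma> = pathstart \<gamma> \<and> path_image \<gamma> \<subseteq> \<Omega> - K) \<and>
     (\<forall>w\<in>K. (\<Sum>\<gamma>\<leftarrow>\<Gamma>. winding_number \<gamma> w) = 1) \<and>
     (\<forall>w. w \<notin> \<Omega> \<longrightarrow> (\<Sum>\<gamma>\<leftarrow>\<Gamma>. winding_number \<gamma> w) = 0)"

definition resolvent :: "complex mat \<Rightarrow> complex \<Rightarrow> complex mat" where
  "resolvent x z = the (mat_inverse (z \<cdot>\<^sub>m 1\<^sub>m (dim_row x) - x))"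

definition riesz_integral ::
    "(real \<Rightarrow> complex) list \<Rightarrow> (complex \<Rightarrow> complex) \<Rightarrow> complex mat \<Rightarrow> complex mat" where
  "riesz_integral \<Gamma> g x = mat (dim_row x) (dim_row x) (\<lambda>(i, j).
     1 / (2 * of_real pi * \<i>) *
       (\<Sum>\<gamma>\<leftarrow>\<Gamma>. contour_integral \<gamma> (\<lambda>z. g z * resolvent x z $$ (i, j))))"

text \<open>The value does not depend on the contour when \<open>\<Omega>\<close> is an open set containing the spectrum
  of \<open>x\<close> and \<open>g\<close> is holomorphic on \<open>\<Omega>\<close>.\<close>

definition riesz_calculus ::
    "complex set \<Rightarrow> (complex \<Rightarrow> complex) \<Rightarrow> complex mat \<Rightarrow> complex mat" where
  "riesz_calculus \<Omega> g x = riesz_integral (SOME \<Gamma>. surrounds_in \<Gamma> (spectrum x) \<Omega>) g x"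

inductive_set generated_matrix_algebra :: "nat \<Rightarrow> complex mat set \<Rightarrow> complex mat set"
  for n :: nat and S :: "complex mat set" where
  generator: "a \<in> S \<Longrightarrow> a \<in> generated_matrix_algebra n S"
| zero: "0\<^sub>m n n \<in> generated_matrix_algebra n S"
| add: "a \<in> generated_matrix_algebra n S \<Longrightarrow> b \<in> generated_matrix_algebra n S \<Longrightarrow>
    a + b \<in> generated_matrix_algebra n S"
| scale: "a \<in> generated_matrix_algebra n S \<Longrightarrow> c \<cdot>\<^sub>m a \<in> generated_matrix_algebra n S"
| mult: "a \<in> generated_matrix_algebra n S \<Longrightarrow> b \<in> generated_matrix_algebra n S \<Longrightarrow>
    a * b \<in> generated_matrix_algebra n S"

end

theory Submission
  imports Defs
begin

text \<open>Conjugating \<open>x \<oplus> y\<close> by a unipotent block matrix shows that \<open>x L = L y\<close> implies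
  \<open>f x L = L f y\<close>. If \<open>u\<^sub>0, \<dots>, u\<^sub>m\<close> are the eigenvalues of \<open>x\<close> with multiplicity, then for every vector
  \<open>v\<close> the map \<open>p \<mapsto> p(x) v\<close> intertwines \<open>x\<close> with the bidiagonal matrix \<open>T\<close> that has the \<open>u\<^sub>i\<close> on the
  diagonal and a small \<open>\<epsilon>\<close> next to it; \<open>T\<close> lies in the domain because \<open>diag(u\<^sub>0, \<dots>, u\<^sub>m)\<close> does. Hence
  \<open>f x = \<Sum>\<^sub>j c\<^sub>j (x - u\<^sub>0) \<cdots> (x - u\<^sub>j\<^sub>-\<^sub>1)\<close> with \<open>\<epsilon>\<^sup>j c\<^sub>j = f(T)\<^sub>j\<^sub>0\<close>. The relation \<open>T f(T) = f(T) T\<close> gives the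
  \<open>c\<^sub>j\<close> the recurrence of the divided differences \<open>f\<^sub>1[u\<^sub>0, \<dots>, u\<^sub>j]\<close>, and local boundedness gives the
  continuity that settles repeated nodes and makes \<open>f\<^sub>1\<close> holomorphic. On the other side, the resolvent is
  \<open>\<Sum>\<^sub>j (x - u\<^sub>0) \<cdots> (x - u\<^sub>j\<^sub>-\<^sub>1) / ((z - u\<^sub>0) \<cdots> (z - u\<^sub>j))\<close>, so the Riesz integral is the same
  combination, with the divided differences written as contour integrals.\<close>

no_notation fps_nth (infixl "$" 75)

section \<open>Cauchy's theorem for cycles\<close>

text \<open>Each loop is reached from the base point \<open>p\<close> by a path \<open>e\<close> in
  \<open>S\<close> run out and back, so the detours cancel in every integral. The outcome replaces a
  cycle in a connected open set by one closed path, to which the single-path form of Cauchy's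
  theorem applies.\<close>

lemma join_loops:
  fixes \<gamma> :: "'i \<Rightarrow> real \<Rightarrow> complex"
  assumes S: "open S" "connected S" "p \<in> S" and "finite I"
    and "\<And>i. i \<in> I \<Longrightarrow> valid_path (\<gamma> i)"
    and "\<And>i. i \<in> I \<Longrightarrow> pathfinish (\<gamma> i) = pathstart (\<gamma> i)"
    and "\<And>i. i \<in> I \<Longrightarrow> path_image (\<gamma> i) \<subseteq> S"
  shows "\<exists>g. valid_path g \<and> pathstart g = p \<and> pathfinish g = p \<and> path_image g \<subseteq> S \<and>
    (\<forall>h. h holomorphic_on S \<longrightarrow> contour_integral g h = (\<Sum>i\<in>I. contour_integral (\<gamma> i) h))"
  using assms(4-)
proof (induction I rule: finite_induct)
  case empty
  show ?case
    using S by (intro exI[of _ "linepath p p"]) (auto simp del: linepath_trivial)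
next
  case (insert i I)
  then obtain g where g: "valid_path g" "pathstart g = p" "pathfinish g = p" "path_image g \<subseteq> S"
    and gint: "\<And>h. h holomorphic_on S \<Longrightarrow> contour_integral g h = (\<Sum>i\<in>I. contour_integral (\<gamma> i) h)"
    by auto
  have \<gamma>: "valid_path (\<gamma> i)" "pathfinish (\<gamma> i) = pathstart (\<gamma> i)" "path_image (\<gamma> i) \<subseteq> S"
    using insert.prems by auto
  then have "pathstart (\<gamma> i) \<in> S"
    using pathstart_in_path_image by blast
  from connected_open_polynomial_connected[OF S this]
  obtain e where e: "polynomial_function e" "path_image e \<subseteq> S" "pathstart e = p"
      "pathfinish e = pathstart (\<gamma> i)"
    by blast
  have ve: "valid_path e"
    using e(1) by (rule valid_path_polynomial_function)
  let ?l = "(e +++ (\<gamma> i +++ reversepath e)) +++ g"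
  have "contour_integral ?l h = (\<Sum>i\<in>insert i I. contour_integral (\<gamma> i) h)"
    if h: "h holomorphic_on S" for h
  proof -
    have "h contour_integrable_on e" "h contour_integrable_on \<gamma> i" "h contour_integrable_on g"
      using contour_integrable_holomorphic_simple[OF h S(1)] ve e \<gamma> g by auto
    then show ?thesis
      using ve e \<gamma> g gint[OF h] insert.hyps
      by (simp add: contour_integral_reversepath contour_integrable_reversepath valid_path_join)
  qed
  moreover have "valid_path ?l" "pathstart ?l = p" "pathfinish ?l = p"
    using ve e \<gamma> g by (auto intro!: valid_path_join)
  moreover have "path_image ?l \<subseteq> S"
    using e \<gamma> g by (simp add: path_image_join)
  ultimately show ?case
    by blast
qed

text \<open>The level sets of a winding number off its path are open, and finitely many paths share
  a neighbourhood.\<close>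

lemma eventually_winding_numbers_eq:
  assumes "finite I" and "\<And>i. i \<in> I \<Longrightarrow> path (\<gamma> i)"
    and "\<And>i. i \<in> I \<Longrightarrow> pathfinish (\<gamma> i) = pathstart (\<gamma> i)"
    and "\<And>i. i \<in> I \<Longrightarrow> z \<notin> path_image (\<gamma> i)"
  shows "\<forall>\<^sub>F w in nhds z. \<forall>i\<in>I. w \<notin> path_image (\<gamma> i) \<and> winding_number (\<gamma> i) w = winding_number (\<gamma> i) z"
proof -
  have "\<forall>\<^sub>F w in nhds z. w \<notin> path_image (\<gamma> i) \<and> winding_number (\<gamma> i) w = winding_number (\<gamma> i) z"
    if "i \<in> I" for i
    using open_winding_number_levelsets[of "\<gamma> i" "winding_number (\<gamma> i) z"] assms that
    by (auto simp: eventually_nhds intro!: exI[of _ "{w. w \<notin> path_image (\<gamma> i) \<and> winding_number (\<gamma> i) w = winding_number (\<gamma> i) z}"])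
  then show ?thesis
    using assms(1) by (simp add: eventually_ball_finite)
qed

lemma path_image_in_component:
  assumes "path g" "path_image g \<subseteq> S"
  shows "path_image g \<subseteq> connected_component_set S (pathstart g)"
  using assms by (intro connected_component_maximal) (auto simp: connected_path_image)

text \<open>If the claim fails, take the rightmost point at which the part of the cycle in some component
  \<open>C\<close> has nonzero index off \<open>C\<close>. The points just right of it must lie in \<open>C\<close>, so it is outside the
  open set, where the total index vanishes; hence a second component is in the same situation and
  meets \<open>C\<close>.\<close>

lemma componentwise_winding_number_zero:
  fixes \<gamma> :: "'i \<Rightarrow> real \<Rightarrow> complex"
  assumes S: "open S" and I: "finite I"
    and vp: "\<And>i. i \<in> I \<Longrightarrow> path (\<gamma> i)"
    and loop: "\<And>i. i \<in> I \<Longrightarrow> pathfinish (\<gamma> i) = pathstart (\<gamma> i)"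
    and img: "\<And>i. i \<in> I \<Longrightarrow> path_image (\<gamma> i) \<subseteq> S"
    and zero: "\<And>w. w \<notin> S \<Longrightarrow> (\<Sum>i\<in>I. winding_number (\<gamma> i) w) = 0"
    and p: "p \<in> S" and w: "w \<notin> connected_component_set S p"
  shows "(\<Sum>i | i \<in> I \<and> connected_component_set S (pathstart (\<gamma> i)) = connected_component_set S p.
            winding_number (\<gamma> i) w) = 0"
proof -
  define c where "c i = connected_component_set S (pathstart (\<gamma> i))" for i
  define W where "W C w = (\<Sum>i | i \<in> I \<and> c i = C. winding_number (\<gamma> i) w)" for C w
  define A where "A C = {w. w \<notin> C \<and> W C w \<noteq> 0}" for C
  define K where "K = (\<Union>C\<in>c ` I. A C)"
  have start: "pathstart (\<gamma> i) \<in> S" if "i \<in> I" for i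
    using img[OF that] pathstart_in_path_image by blast
  have comp: "C \<in> components S" if "C \<in> c ` I" for C
    using that start by (auto simp: c_def components_def)
  have openC: "open C" if "C \<in> c ` I" for C
    using comp[OF that] S open_components by blast
  have imgC: "path_image (\<gamma> i) \<subseteq> c i" if "i \<in> I" for i
    unfolding c_def using path_image_in_component vp img that by blast
  have locW: "\<forall>\<^sub>F w in nhds z. W C w = W C z" if "z \<notin> C" for C z
  proof -
    have "\<forall>\<^sub>F w in nhds z. \<forall>i\<in>{i \<in> I. c i = C}. w \<notin> path_image (\<gamma> i) \<and>
        winding_number (\<gamma> i) w = winding_number (\<gamma> i) z"
      using vp loop imgC that I by (intro eventually_winding_numbers_eq) auto
    then show ?thesis
      by eventually_elim (auto simp: W_def intro!: sum.cong)
  qed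
  have bdd: "bounded (A C)" for C
  proof -
    have "A C \<subseteq> (\<Union>i\<in>I. {w. winding_number (\<gamma> i) w \<noteq> 0})"
      by (auto simp: A_def W_def dest: sum.not_neutral_contains_not_neutral)
    moreover have "bounded (\<Union>i\<in>I. {w. winding_number (\<gamma> i) w \<noteq> 0})"
      using I vp loop bounded_winding_number_nz by blast
    ultimately show ?thesis
      using bounded_subset by blast
  qed
  have clo: "closed (A C)" if "C \<in> c ` I" for C
  proof -
    have "open (- A C)"
    proof (subst open_subopen, safe)
      fix z assume z: "z \<notin> A C"
      show "\<exists>T. open T \<and> z \<in> T \<and> T \<subseteq> - A C"
      proof (cases "z \<in> C")
        case True
        then show ?thesis
          using openC[OF that] by (intro exI[of _ C]) (auto simp: A_def)
      next
        case False
        then have "\<forall>\<^sub>F w in nhds z. W C w = 0"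
          using locW[OF False] z by (simp add: A_def)
        then show ?thesis
          unfolding eventually_nhds by (auto simp: A_def)
      qed
    qed
    then show ?thesis
      by (simp add: closed_def)
  qed
  have compK: "compact K"
    unfolding K_def using I bdd clo by (intro compact_UN) (auto simp: compact_eq_bounded_closed)
  have "K = {}"
  proof (rule ccontr)
    assume "K \<noteq> {}"
    then obtain z where z: "z \<in> K" and max: "\<And>w. w \<in> K \<Longrightarrow> Re w \<le> Re z"
      using continuous_attains_sup[OF compK, of Re] continuous_on_Re[OF continuous_on_id] by auto
    have right: "\<forall>\<^sub>F t in at_right 0. z + of_real t \<in> C" if C: "C \<in> c ` I" and zC: "z \<in> A C" for C
    proof -
      have "((\<lambda>t. z + of_real t) \<longlongrightarrow> z) (at_right (0::real))"
        by (auto intro!: tendsto_eq_intros)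
      then have "\<forall>\<^sub>F t in at_right 0. W C (z + of_real t) = W C z"
        using locW[of z C] zC unfolding A_def filterlim_iff by auto
      moreover have "\<forall>\<^sub>F t in at_right 0. (0::real) < t"
        by (rule eventually_at_right_less)
      ultimately show ?thesis
      proof eventually_elim
        case (elim t)
        show ?case
        proof (rule ccontr)
          assume "z + of_real t \<notin> C"
          then have "z + of_real t \<in> K"
            using elim zC C by (auto simp: K_def A_def)
          from max[OF this] elim show False by simp
        qed
      qed
    qed
    obtain C where C: "C \<in> c ` I" "z \<in> A C"
      using z by (auto simp: K_def)
    have nS: "z \<notin> S"
    proof
      assume "z \<in> S"
      define C' where "C' = connected_component_set S z"
      have C': "open C'" "z \<in> C'" "C' \<in> components S"
        using S \<open>z \<in> S\<close> by (auto simp: C'_def open_connected_component componentsI)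
      have "((\<lambda>t. z + of_real t) \<longlongrightarrow> z) (at_right (0::real))"
        by (auto intro!: tendsto_eq_intros)
      then have "\<forall>\<^sub>F t in at_right (0::real). z + of_real t \<in> C'"
        using C' topological_tendstoD by blast
      with right[OF C] have "\<forall>\<^sub>F t in at_right (0::real). z + of_real t \<in> C \<inter> C'"
        by eventually_elim auto
      then have "C \<inter> C' \<noteq> {}"
        using eventually_happens[of _ "at_right (0::real)"] by fastforce
      then have "C = C'"
        using comp[OF C(1)] C'(3) components_nonoverlap by blast
      then show False
        using C(2) C'(2) by (auto simp: A_def)
    qed
    have "(\<Sum>C\<in>c ` I. W C z) = 0"
      unfolding W_def using zero[OF nS] sum.image_gen[OF I, of "\<lambda>i. winding_number (\<gamma> i) z" c] by simp
    moreover have "W C z \<noteq> 0"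
      using C(2) by (auto simp: A_def)
    ultimately obtain C' where C': "C' \<in> c ` I" "C' \<noteq> C" "W C' z \<noteq> 0"
      using I C(1) by (metis (no_types, lifting) finite_imageI sum.remove sum.neutral add.right_neutral
          Diff_iff insertI1)
    have "z \<notin> C'"
      using comp[OF C'(1)] nS in_components_subset by blast
    then have "z \<in> A C'"
      using C' by (simp add: A_def)
    from right[OF C] right[OF C'(1) this]
    have "\<forall>\<^sub>F t in at_right (0::real). z + of_real t \<in> C \<inter> C'"
      by eventually_elim auto
    then have "C \<inter> C' \<noteq> {}"
      using eventually_happens[of _ "at_right (0::real)"] by fastforce
    then show False
      using comp[OF C(1)] comp[OF C'(1)] components_nonoverlap C'(2) by blast
  qed
  then have "W C w = 0" if "C \<in> c ` I" "w \<notin> C" for C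
    using that by (auto simp: K_def A_def)
  moreover have "W C w = 0" if "C \<notin> c ` I" for C
    using that by (auto simp: W_def intro!: sum.neutral)
  ultimately have "W (connected_component_set S p) w = 0"
    using w by (cases "connected_component_set S p \<in> c ` I") simp_all
  then show ?thesis
    by (simp add: W_def c_def)
qed

text \<open>The loops are grouped by the component of \<open>S\<close> that contains them. By
  \<open>componentwise_winding_number_zero\<close> each group has index zero off its own component,
  so after joining it into one loop the single-path theorem applies there.\<close>

theorem Cauchy_theorem_cycle:
  fixes \<gamma> :: "'i \<Rightarrow> real \<Rightarrow> complex"
  assumes S: "open S" and h: "h holomorphic_on S" and I: "finite I"
    and vp: "\<And>i. i \<in> I \<Longrightarrow> valid_path (\<gamma> i)"
    and loop: "\<And>i. i \<in> I \<Longrightarrow> pathfinish (\<gamma> i) = pathstart (\<gamma> i)"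
    and img: "\<And>i. i \<in> I \<Longrightarrow> path_image (\<gamma> i) \<subseteq> S"
    and zero: "\<And>w. w \<notin> S \<Longrightarrow> (\<Sum>i\<in>I. winding_number (\<gamma> i) w) = 0"
  shows "(\<Sum>i\<in>I. contour_integral (\<gamma> i) h) = 0"
proof -
  define c where "c i = connected_component_set S (pathstart (\<gamma> i))" for i
  have "(\<Sum>i | i \<in> I \<and> c i = c k. contour_integral (\<gamma> i) h) = 0" if k: "k \<in> I" for k
  proof -
    define p where "p = pathstart (\<gamma> k)"
    define J where "J = {i. i \<in> I \<and> c i = c k}"
    have p: "p \<in> S"
      using img[OF k] pathstart_in_path_image by (auto simp: p_def)
    have cp: "c k = connected_component_set S p"
      by (simp add: c_def p_def)
    have ck: "open (c k)" "connected (c k)" "p \<in> c k" "c k \<subseteq> S"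
      using S p by (auto simp: cp open_connected_component connected_component_subset)
    have J: "finite J" "J \<subseteq> I" "\<And>i. i \<in> J \<Longrightarrow> path_image (\<gamma> i) \<subseteq> c k"
      using I path_image_in_component[OF valid_path_imp_path[OF vp] img]
      by (auto simp: J_def c_def)
    obtain g where g: "valid_path g" "pathstart g = p" "pathfinish g = p" "path_image g \<subseteq> c k"
      and gint: "\<And>h. h holomorphic_on c k \<Longrightarrow>
        contour_integral g h = (\<Sum>i\<in>J. contour_integral (\<gamma> i) h)"
      using join_loops[OF ck(1-3) J(1), of \<gamma>] J vp loop by blast
    have "winding_number g w = 0" if w: "w \<notin> c k" for w
    proof -
      \<comment> \<open>The winding number is itself the integral of a function holomorphic on
        \<open>c k\<close>, because \<open>w\<close> lies outside; so \<open>gint\<close> turns the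
        index of \<open>g\<close> into the sum of the indices of the group.\<close>
      have hol: "(\<lambda>z. 1 / (z - w)) holomorphic_on c k"
        using w by (auto intro!: holomorphic_intros)
      have wi: "w \<notin> path_image g" "\<And>i. i \<in> J \<Longrightarrow> w \<notin> path_image (\<gamma> i)"
        using w g J by auto
      have "winding_number g w = (\<Sum>i\<in>J. winding_number (\<gamma> i) w)"
        using wi g J vp by (simp add: winding_number_valid_path gint[OF hol] sum_distrib_left subset_eq)
      also have "\<dots> = 0"
        using componentwise_winding_number_zero[OF S I _ loop img zero p, of w] vp w valid_path_imp_path
        unfolding J_def cp unfolding c_def by auto
      finally show ?thesis .
    qed
    then have "(h has_contour_integral 0) g"
      using g ck h holomorphic_on_subset by (intro Cauchy_theorem_global[of "c k"]) auto
    then have "contour_integral g h = 0"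
      by (rule contour_integral_unique)
    then show ?thesis
      using gint[OF holomorphic_on_subset[OF h ck(4)]] by (simp add: J_def)
  qed
  then have "(\<Sum>C\<in>c ` I. \<Sum>i | i \<in> I \<and> c i = C. contour_integral (\<gamma> i) h) = 0"
    by (intro sum.neutral) blast
  then show ?thesis
    using sum.image_gen[OF I, of "\<lambda>i. contour_integral (\<gamma> i) h" c] by simp
qed

section \<open>The free topology\<close>

lemma cmod_le_euclid_norm: "i < dim_vec v \<Longrightarrow> cmod (v $ i) \<le> euclid_norm v"
  unfolding euclid_norm_def by (rule member_le_L2_set) auto

lemma euclid_norm_le_sum: "euclid_norm v \<le> (\<Sum>i<dim_vec v. cmod (v $ i))"
  unfolding euclid_norm_def by (rule L2_set_le_sum) auto

text \<open>A crude bound whose purpose is to make the set under the supremum in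
  \<open>op_norm\<close> bounded above, so that \<open>Sup\<close> is a genuine least upper bound.
  It also supplies the error term in \<open>op_norm_le_perturb\<close>.\<close>

lemma euclid_norm_mult_vec_le:
  assumes "v \<in> carrier_vec (dim_col A)" "euclid_norm v \<le> 1"
  shows "euclid_norm (A *\<^sub>v v) \<le> (\<Sum>i<dim_row A. \<Sum>j<dim_col A. cmod (A $$ (i, j)))"
proof -
  have "cmod ((A *\<^sub>v v) $ i) \<le> (\<Sum>j<dim_col A. cmod (A $$ (i, j)))" if "i < dim_row A" for i
  proof -
    have "cmod (v $ j) \<le> 1" if "j < dim_col A" for j
      using cmod_le_euclid_norm[of j v] that assms by auto
    then have "cmod (A $$ (i, j) * v $ j) \<le> cmod (A $$ (i, j))" if "j < dim_col A" for j
      using that mult_left_le[of "cmod (v $ j)" "cmod (A $$ (i, j))"] by (simp add: norm_mult)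
    then show ?thesis
      using that assms(1) by (auto simp: scalar_prod_def atLeast0LessThan intro!: sum_norm_le)
  qed
  then have "(\<Sum>i<dim_row A. cmod ((A *\<^sub>v v) $ i)) \<le> (\<Sum>i<dim_row A. \<Sum>j<dim_col A. cmod (A $$ (i, j)))"
    by (intro sum_mono) simp
  then show ?thesis
    using euclid_norm_le_sum[of "A *\<^sub>v v"] by simp
qed

lemma euclid_norm_mult_vec_le_op_norm:
  assumes "v \<in> carrier_vec (dim_col A)" "euclid_norm v \<le> 1"
  shows "euclid_norm (A *\<^sub>v v) \<le> op_norm A"
  unfolding op_norm_def
proof (rule cSup_upper)
  show "bdd_above {euclid_norm (A *\<^sub>v v) |v. v \<in> carrier_vec (dim_col A) \<and> euclid_norm v \<le> 1}"
    using euclid_norm_mult_vec_le[of _ A] by (auto intro!: bdd_aboveI)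
qed (use assms in auto)

lemma euclid_norm_zero: "euclid_norm (0\<^sub>v n) = 0"
  by (simp add: euclid_norm_def L2_set_def)

lemma op_norm_le:
  assumes "\<And>v. v \<in> carrier_vec (dim_col A) \<Longrightarrow> euclid_norm v \<le> 1 \<Longrightarrow> euclid_norm (A *\<^sub>v v) \<le> c"
  shows "op_norm A \<le> c"
  unfolding op_norm_def
proof (rule cSup_least)
  show "{euclid_norm (A *\<^sub>v v) |v. v \<in> carrier_vec (dim_col A) \<and> euclid_norm v \<le> 1} \<noteq> {}"
    using euclid_norm_zero[of "dim_col A"] zero_carrier_vec[of "dim_col A"]
    by (metis (mono_tags, lifting) empty_Collect_eq zero_le_one)
qed (use assms in auto)

lemma cmod_le_op_norm:
  assumes "i < dim_row A" "j < dim_col A"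
  shows "cmod (A $$ (i, j)) \<le> op_norm A"
proof -
  have "euclid_norm (unit_vec (dim_col A) j) \<le> 1"
    using assms by (simp add: euclid_norm_def L2_set_def unit_vec_def if_distribR if_distrib[of cmod]
        if_distrib[of "\<lambda>x. x\<^sup>2"] cong: if_cong)
  from euclid_norm_mult_vec_le_op_norm[OF _ this]
  have "euclid_norm (A *\<^sub>v unit_vec (dim_col A) j) \<le> op_norm A"
    by simp
  moreover have "(A *\<^sub>v unit_vec (dim_col A) j) $ i = A $$ (i, j)"
    using assms by simp
  ultimately show ?thesis
    using cmod_le_euclid_norm[of i "A *\<^sub>v unit_vec (dim_col A) j"] assms by simp
qed

text \<open>The triangle inequality for \<open>L2_set\<close>, applied to A v = B v + (A - B) v. It
  makes \<open>op_norm\<close> continuous in the entries.\<close>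

lemma op_norm_le_perturb:
  assumes A: "A \<in> carrier_mat r c" and B: "B \<in> carrier_mat r c"
  shows "op_norm A \<le> op_norm B + (\<Sum>i<r. \<Sum>j<c. cmod (A $$ (i, j) - B $$ (i, j)))"
proof (rule op_norm_le)
  fix v assume v: "v \<in> carrier_vec (dim_col A)" "euclid_norm v \<le> 1"
  have "(A - B) *\<^sub>v v = A *\<^sub>v v - B *\<^sub>v v"
    using A B v by (intro minus_mult_distrib_mat_vec[of _ r c]) auto
  then have eq: "cmod ((A *\<^sub>v v) $ i) \<le> cmod ((B *\<^sub>v v) $ i) + cmod (((A - B) *\<^sub>v v) $ i)"
    if "i < r" for i
    using that A B norm_triangle_ineq[of "(B *\<^sub>v v) $ i" "((A - B) *\<^sub>v v) $ i"] by simp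
  have "euclid_norm (A *\<^sub>v v) \<le> L2_set (\<lambda>i. cmod ((B *\<^sub>v v) $ i) + cmod (((A - B) *\<^sub>v v) $ i)) {..<r}"
    using eq A by (auto simp: euclid_norm_def intro!: L2_set_mono)
  also have "\<dots> \<le> euclid_norm (B *\<^sub>v v) + euclid_norm ((A - B) *\<^sub>v v)"
    using A B L2_set_triangle_ineq by (auto simp: euclid_norm_def)
  also have "\<dots> \<le> op_norm B + (\<Sum>i<r. \<Sum>j<c. cmod (A $$ (i, j) - B $$ (i, j)))"
  proof (rule add_mono)
    show "euclid_norm (B *\<^sub>v v) \<le> op_norm B"
      using A B v by (intro euclid_norm_mult_vec_le_op_norm) auto
    show "euclid_norm ((A - B) *\<^sub>v v) \<le> (\<Sum>i<r. \<Sum>j<c. cmod (A $$ (i, j) - B $$ (i, j)))"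
      using euclid_norm_mult_vec_le[of v "A - B"] A B v by auto
  qed
  finally show "euclid_norm (A *\<^sub>v v) \<le> op_norm B + (\<Sum>i<r. \<Sum>j<c. cmod (A $$ (i, j) - B $$ (i, j)))" .
qed

section \<open>Entrywise convergence and openness of free sets at a fixed size\<close>

definition tends_entrywise ::
    "nat \<Rightarrow> nat \<Rightarrow> ('t \<Rightarrow> complex mat) \<Rightarrow> complex mat \<Rightarrow> 't filter \<Rightarrow> bool" where
  "tends_entrywise r c M y F \<longleftrightarrow> (\<forall>t. M t \<in> carrier_mat r c) \<and> y \<in> carrier_mat r c \<and>
     (\<forall>i<r. \<forall>j<c. ((\<lambda>t. M t $$ (i, j)) \<longlongrightarrow> y $$ (i, j)) F)"

lemma tends_entrywiseD:
  assumes "tends_entrywise r c M y F"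
  shows "M t \<in> carrier_mat r c" "y \<in> carrier_mat r c"
    and "i < r \<Longrightarrow> j < c \<Longrightarrow> ((\<lambda>t. M t $$ (i, j)) \<longlongrightarrow> y $$ (i, j)) F"
  using assms by (auto simp: tends_entrywise_def)

lemma tends_entrywiseI:
  assumes "\<And>t. M t \<in> carrier_mat r c" "y \<in> carrier_mat r c"
    and "\<And>i j. i < r \<Longrightarrow> j < c \<Longrightarrow> ((\<lambda>t. M t $$ (i, j)) \<longlongrightarrow> y $$ (i, j)) F"
  shows "tends_entrywise r c M y F"
  using assms by (auto simp: tends_entrywise_def)

lemma tends_entrywise_mult:
  assumes "tends_entrywise r c M y F" "tends_entrywise c d N z F"
  shows "tends_entrywise r d (\<lambda>t. M t * N t) (y * z) F"
proof -
  note M = tends_entrywiseD[OF assms(1)] and N = tends_entrywiseD[OF assms(2)]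
  note [simp] = M(1,2)[THEN carrier_matD(1)] M(1,2)[THEN carrier_matD(2)]
    N(1,2)[THEN carrier_matD(1)] N(1,2)[THEN carrier_matD(2)]
  show ?thesis
  proof (rule tends_entrywiseI)
    fix i j assume ij: "i < r" "j < d"
    have "((\<lambda>t. \<Sum>k<c. M t $$ (i, k) * N t $$ (k, j)) \<longlongrightarrow> (\<Sum>k<c. y $$ (i, k) * z $$ (k, j))) F"
      using ij by (intro tendsto_sum tendsto_mult M(3) N(3)) auto
    then show "((\<lambda>t. (M t * N t) $$ (i, j)) \<longlongrightarrow> (y * z) $$ (i, j)) F"
      using ij by (simp add: scalar_prod_def atLeast0LessThan)
  qed (rule mult_carrier_mat[OF M(1) N(1)] mult_carrier_mat[OF M(2) N(2)])+
qed

lemma tends_entrywise_const: "y \<in> carrier_mat r c \<Longrightarrow> tends_entrywise r c (\<lambda>t. y) y F"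
  by (simp add: tends_entrywise_def)

lemma tends_entrywise_pow:
  assumes "tends_entrywise n n M y F"
  shows "tends_entrywise n n (\<lambda>t. M t ^\<^sub>m k) (y ^\<^sub>m k) F"
proof (induction k)
  case 0
  show ?case
    using tends_entrywiseD(1,2)[OF assms, THEN carrier_matD(1)]
    by (simp add: tends_entrywise_const)
next
  case (Suc k)
  then show ?case
    using tends_entrywise_mult[OF Suc assms] by simp
qed

lemma tends_entrywise_poly_mat_at:
  assumes M: "tends_entrywise n n M y F" and n: "0 < n"
  shows "tends_entrywise (dim_row \<delta> * n) (dim_col \<delta> * n)
    (\<lambda>t. poly_mat_at \<delta> (M t)) (poly_mat_at \<delta> y) F"
proof -
  note [simp] = tends_entrywiseD(1,2)[OF M, THEN carrier_matD(1)]
  have p: "((\<lambda>t. poly_at p (M t) $$ (i, j)) \<longlongrightarrow> poly_at p y $$ (i, j)) F" if "i < n" "j < n" for p i j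
  proof -
    have "((\<lambda>t. \<Sum>k\<le>degree p. coeff p k * (M t ^\<^sub>m k) $$ (i, j)) \<longlongrightarrow>
        (\<Sum>k\<le>degree p. coeff p k * (y ^\<^sub>m k) $$ (i, j))) F"
      using that by (intro tendsto_intros tends_entrywiseD(3)[OF tends_entrywise_pow[OF M]])
    then show ?thesis
      using that by (simp add: poly_at_def)
  qed
  show ?thesis
  proof (rule tends_entrywiseI)
    fix i j assume "i < dim_row \<delta> * n" "j < dim_col \<delta> * n"
    then show "((\<lambda>t. poly_mat_at \<delta> (M t) $$ (i, j)) \<longlongrightarrow> poly_mat_at \<delta> y $$ (i, j)) F"
      using n p[of "i mod n" "j mod n"] by (simp add: poly_mat_at_def Let_def)
  qed (simp_all add: poly_mat_at_def Let_def)
qed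

text \<open>The entries of \<open>poly_mat_at \<delta>\<close> are polynomials in those of the
  matrix and \<open>op_norm\<close> is continuous in the entries, so the strict inequality survives
  nearby.\<close>

lemma eventually_free_ball:
  assumes M: "tends_entrywise n n M y F" and y: "y \<in> free_ball \<delta>"
  shows "\<forall>\<^sub>F t in F. M t \<in> free_ball \<delta>"
proof -
  note yc = tends_entrywiseD(2)[OF M] and Mc = tends_entrywiseD(1)[OF M]
  have n: "0 < n"
    using y yc by (auto simp: free_ball_def nc_universe_def)
  let ?A = "\<lambda>t. poly_mat_at \<delta> (M t)" and ?B = "poly_mat_at \<delta> y"
  let ?r = "dim_row \<delta> * n" and ?c = "dim_col \<delta> * n"
  have *: "tends_entrywise ?r ?c ?A ?B F"
    using tends_entrywise_poly_mat_at[OF M n] .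
  have lim: "((\<lambda>t. op_norm ?B + (\<Sum>i<?r. \<Sum>j<?c. cmod (?A t $$ (i, j) - ?B $$ (i, j))))
      \<longlongrightarrow> op_norm ?B + (\<Sum>i<?r. \<Sum>j<?c. cmod (?B $$ (i, j) - ?B $$ (i, j)))) F"
    by (intro tendsto_intros tends_entrywiseD(3)[OF *]) auto
  have "\<forall>\<^sub>F t in F. op_norm ?B + (\<Sum>i<?r. \<Sum>j<?c. cmod (?A t $$ (i, j) - ?B $$ (i, j))) < 1"
    using y by (intro order_tendstoD(2)[OF lim]) (simp add: free_ball_def)
  then show ?thesis
  proof eventually_elim
    case (elim t)
    have "op_norm (?A t) \<le> op_norm ?B + (\<Sum>i<?r. \<Sum>j<?c. cmod (?A t $$ (i, j) - ?B $$ (i, j)))"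
      by (intro op_norm_le_perturb tends_entrywiseD(1,2)[OF *])
    then show ?case
      using elim Mc n by (auto simp: free_ball_def nc_universe_def intro!: bexI[of _ n])
  qed
qed

lemma freely_openE:
  assumes "freely_open U" "x \<in> U"
  obtains \<delta> where "x \<in> free_ball \<delta>" "free_ball \<delta> \<subseteq> U"
  using assms unfolding freely_open_def union_of_def arbitrary_def by blast

lemma eventually_freely_open:
  assumes "tends_entrywise n n M y F" "freely_open V" "y \<in> V"
  shows "\<forall>\<^sub>F t in F. M t \<in> V"
proof -
  obtain \<delta> where \<delta>: "y \<in> free_ball \<delta>" "free_ball \<delta> \<subseteq> V"
    using assms(2,3) by (rule freely_openE)
  show ?thesis
    using eventually_free_ball[OF assms(1) \<delta>(1)] by eventually_elim (use \<delta>(2) in blast)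
qed

lemma freely_open_subset_nc_universe: "freely_open U \<Longrightarrow> U \<subseteq> nc_universe"
  by (auto elim!: freely_openE simp: free_ball_def)

abbreviation scalar_mat :: "complex \<Rightarrow> complex mat" where
  "scalar_mat z \<equiv> mat 1 1 (\<lambda>_. z)"

lemma open_level1:
  assumes "freely_open U"
  shows "open (level1 U)"
proof (subst open_subopen, safe)
  fix z assume z: "z \<in> level1 U"
  have "\<forall>\<^sub>F w in nhds z. scalar_mat w \<in> U"
    by (rule eventually_freely_open[of 1 _ "scalar_mat z"])
      (use assms z in \<open>auto simp: level1_def tends_entrywise_def filterlim_ident\<close>)
  then show "\<exists>T. open T \<and> z \<in> T \<and> T \<subseteq> level1 U"
    by (auto simp: eventually_nhds level1_def)
qed

section \<open>Eigenvalues of the points of a free ball\<close>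

lemma sum_lessThan_mult:
  fixes f :: "nat \<Rightarrow> 'a::comm_monoid_add"
  shows "(\<Sum>i<r * n. f i) = (\<Sum>a<r. \<Sum>b<n. f (a * n + b))"
proof -
  have "sum f {a * n..<a * n + n} = (\<Sum>b<n. f (a * n + b))" for a
    using sum.shift_bounds_nat_ivl[of f 0 "a * n" n] by (simp add: add.commute atLeast0LessThan)
  then show ?thesis
    by (simp add: sum.nat_group[symmetric])
qed

lemma poly_at_mult_eigenvector:
  fixes v :: "complex vec"
  assumes x: "x \<in> carrier_mat n n" and v: "eigenvector x v k" and b: "b < n"
  shows "(\<Sum>j<n. poly_at p x $$ (b, j) * v $ j) = poly p k * v $ b"
proof -
  have vd: "v \<in> carrier_vec n"
    using v x by (auto simp: eigenvector_def)
  have pow: "(\<Sum>j<n. (x ^\<^sub>m m) $$ (b, j) * v $ j) = k ^ m * v $ b" for m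
  proof -
    have "(x ^\<^sub>m m *\<^sub>v v) $ b = (k ^ m \<cdot>\<^sub>v v) $ b"
      using eigenvector_pow[OF x v] by simp
    then show ?thesis
      using b vd carrier_matD[OF pow_carrier_mat[OF x, of m]] by (simp add: scalar_prod_def atLeast0LessThan)
  qed
  have "(\<Sum>j<n. poly_at p x $$ (b, j) * v $ j) =
      (\<Sum>j<n. \<Sum>m\<le>degree p. coeff p m * ((x ^\<^sub>m m) $$ (b, j) * v $ j))"
    using x b by (simp add: poly_at_def sum_distrib_right mult.assoc)
  also have "\<dots> = (\<Sum>m\<le>degree p. coeff p m * (k ^ m * v $ b))"
    by (subst sum.swap) (simp add: pow sum_distrib_left[symmetric])
  finally show ?thesis
    by (simp add: poly_altdef sum_distrib_right mult.assoc)
qed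

text \<open>If \<open>x v = k v\<close> with \<open>\<parallel>v\<parallel> = 1\<close> then \<open>\<delta>(x) (u \<otimes> v) = \<delta>(k) u \<otimes> v\<close>.\<close>

lemma op_norm_poly_mat_at_eigenvalue:
  assumes x: "x \<in> carrier_mat n n" and k: "eigenvalue x k"
  shows "op_norm (poly_mat_at \<delta> (scalar_mat k)) \<le> op_norm (poly_mat_at \<delta> x)"
proof (rule op_norm_le)
  let ?D = "poly_mat_at \<delta> (scalar_mat k)"
  fix u assume u: "u \<in> carrier_vec (dim_col ?D)" "euclid_norm u \<le> 1"
  define r c where "r = dim_row \<delta>" and "c = dim_col \<delta>"
  have Dd: "dim_row ?D = r" "dim_col ?D = c"
    by (simp_all add: poly_mat_at_def r_def c_def)
  have pow1: "(scalar_mat k ^\<^sub>m m) $$ (0, 0) = k ^ m" for m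
    by (induction m) (auto simp: scalar_prod_def)
  have D: "?D $$ (a, b) = poly (\<delta> $$ (a, b)) k" if "a < r" "b < c" for a b
    using that by (simp add: poly_mat_at_def r_def c_def poly_at_def pow1[unfolded One_nat_def] poly_altdef)
  obtain v where v: "eigenvector x v k"
    using k by (auto simp: eigenvalue_def)
  have vn: "v \<in> carrier_vec n" "v \<noteq> 0\<^sub>v n"
    using v x by (auto simp: eigenvector_def)
  have n: "0 < n"
    using vn by (cases n) auto
  define N where "N = euclid_norm v"
  have "N > 0"
  proof -
    obtain i where "i < n" "v $ i \<noteq> 0"
      using vn by (metis carrier_vecD eq_vecI index_zero_vec(1) index_zero_vec(2))
    then have "0 < cmod (v $ i)" "i < dim_vec v"
      using vn by auto
    with cmod_le_euclid_norm[of i v] show ?thesis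
      unfolding N_def by linarith
  qed
  \<comment> \<open>Here \<open>v\<close> is an arbitrary eigenvector, so u \<otimes> v is divided
    by its norm \<open>N\<close>; by \<open>tensor\<close> the result has the norm of
    \<open>u\<close>.\<close>
  define w where "w = vec (c * n) (\<lambda>j. u $ (j div n) * (v $ (j mod n)) / of_real N)"
  have tensor: "euclid_norm (vec (d * n) (\<lambda>j. p $ (j div n) * (v $ (j mod n)) / of_real N)) = euclid_norm p"
    if "p \<in> carrier_vec d" for p d
  proof -
    have "(\<Sum>i<d * n. (cmod (p $ (i div n) * v $ (i mod n) / of_real N))\<^sup>2) =
        (\<Sum>a<d. (cmod (p $ a))\<^sup>2) * (\<Sum>b<n. (cmod (v $ b))\<^sup>2) / N\<^sup>2"
      using n by (simp add: sum_lessThan_mult sum_product norm_mult norm_divide power_mult_distrib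
          power_divide sum_divide_distrib)
    also have "(\<Sum>b<n. (cmod (v $ b))\<^sup>2) = N\<^sup>2"
      using vn by (simp add: N_def euclid_norm_def L2_set_def sum_nonneg)
    finally show ?thesis
      using that \<open>N > 0\<close> by (simp add: euclid_norm_def L2_set_def)
  qed
  let ?X = "poly_mat_at \<delta> x"
  have Xd: "dim_row ?X = r * n" "dim_col ?X = c * n"
    using x by (simp_all add: poly_mat_at_def r_def c_def)
  have "?X *\<^sub>v w = vec (r * n) (\<lambda>j. (?D *\<^sub>v u) $ (j div n) * (v $ (j mod n)) / of_real N)"
  proof (rule eq_vecI)
    fix i assume "i < dim_vec (vec (r * n) (\<lambda>j. (?D *\<^sub>v u) $ (j div n) * (v $ (j mod n)) / of_real N))"
    then have i: "i < r * n" by simp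
    then have ia: "i div n < r" "i mod n < n"
      using n by (auto simp: less_mult_imp_div_less)
    have "(?X *\<^sub>v w) $ i = (\<Sum>j<c * n. ?X $$ (i, j) * w $ j)"
      using i Xd by (simp add: scalar_prod_def atLeast0LessThan w_def)
    also have "\<dots> = (\<Sum>j<c * n. poly_at (\<delta> $$ (i div n, j div n)) x $$ (i mod n, j mod n) *
        (u $ (j div n) * (v $ (j mod n)) / of_real N))"
      using x i by (intro sum.cong) (auto simp: w_def poly_mat_at_def r_def c_def Let_def)
    also have "\<dots> = (\<Sum>a<c. u $ a / of_real N * (\<Sum>b<n. poly_at (\<delta> $$ (i div n, a)) x $$ (i mod n, b) * v $ b))"
      using n by (simp add: sum_lessThan_mult sum_distrib_left algebra_simps)
    also have "\<dots> = (\<Sum>a<c. u $ a / of_real N * (?D $$ (i div n, a) * v $ (i mod n)))"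
      by (intro sum.cong refl) (simp only: poly_at_mult_eigenvector[OF x v ia(2)] D[OF ia(1)] lessThan_iff)
    also have "\<dots> = (\<Sum>a<c. ?D $$ (i div n, a) * u $ a) * v $ (i mod n) / of_real N"
      unfolding sum_distrib_right sum_divide_distrib by (intro sum.cong refl) simp
    also have "(\<Sum>a<c. ?D $$ (i div n, a) * u $ a) = (?D *\<^sub>v u) $ (i div n)"
      using ia u Dd by (simp add: scalar_prod_def atLeast0LessThan)
    finally show "(?X *\<^sub>v w) $ i = vec (r * n) (\<lambda>j. (?D *\<^sub>v u) $ (j div n) * (v $ (j mod n)) / of_real N) $ i"
      using i by simp
  qed (simp add: Xd)
  then have "euclid_norm (?D *\<^sub>v u) = euclid_norm (?X *\<^sub>v w)"
    using tensor[of "?D *\<^sub>v u" r] Dd by (simp add: carrier_vecI)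
  also have "\<dots> \<le> op_norm ?X"
    using tensor[of u c] u Dd Xd
    by (intro euclid_norm_mult_vec_le_op_norm) (auto simp: w_def)
  finally show "euclid_norm (?D *\<^sub>v u) \<le> op_norm ?X" .
qed

text \<open>A basic ball around \<open>x\<close> inside \<open>U\<close> also contains the 1 by 1
  matrix of each eigenvalue, because passing from \<open>x\<close> to an eigenvalue does not
  increase the norm of \<open>\<delta>\<close>.\<close>

lemma spectrum_subset_level1:
  assumes "freely_open U" "x \<in> U"
  shows "spectrum x \<subseteq> level1 U"
proof
  fix k assume k: "k \<in> spectrum x"
  obtain \<delta> where \<delta>: "x \<in> free_ball \<delta>" "free_ball \<delta> \<subseteq> U"
    using assms by (rule freely_openE)
  then obtain n where "x \<in> carrier_mat n n"
    by (auto simp: free_ball_def nc_universe_def)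
  then have "scalar_mat k \<in> free_ball \<delta>"
    using op_norm_poly_mat_at_eigenvalue[of x n k \<delta>] k \<delta>(1)
    by (auto simp: spectrum_def free_ball_def nc_universe_def intro!: bexI[of _ 1])
  then show "k \<in> level1 U"
    using \<delta> by (auto simp: level1_def)
qed

section \<open>Locally bounded nc-functions\<close>

text \<open>The upper right corner measures how far \<open>L\<close> is from intertwining
  \<open>a\<close> and \<open>b\<close>. The identity is applied both to a pair of points and to the
  pair of their images under \<open>f\<close>.\<close>

lemma block_conjugate:
  assumes a: "a \<in> carrier_mat n n" and b: "b \<in> carrier_mat m m" and L: "L \<in> carrier_mat n m"
  shows "four_block_mat (1\<^sub>m n) (- L) (0\<^sub>m m n) (1\<^sub>m m) * (a \<oplus>\<^sub>d b) *
      four_block_mat (1\<^sub>m n) L (0\<^sub>m m n) (1\<^sub>m m) =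
    four_block_mat a (a * L - L * b) (0\<^sub>m m n) b"
proof -
  have Lb: "L * b \<in> carrier_mat n m" and aL: "a * L \<in> carrier_mat n m"
    using a b L by auto
  have "four_block_mat (1\<^sub>m n) (- L) (0\<^sub>m m n) (1\<^sub>m m) * (a \<oplus>\<^sub>d b) =
      four_block_mat a (- (L * b)) (0\<^sub>m m n) b"
    unfolding nc_sum_def using a b L Lb
    by (subst mult_four_block_mat[of _ n n _ m _ m _ _ n _ m]) auto
  moreover have "four_block_mat a (- (L * b)) (0\<^sub>m m n) b *
      four_block_mat (1\<^sub>m n) L (0\<^sub>m m n) (1\<^sub>m m) = four_block_mat a (a * L - L * b) (0\<^sub>m m n) b"
    using a b L Lb aL
    by (subst mult_four_block_mat[of _ n n _ m _ m _ _ n _ m]) (auto simp: add_uminus_minus_mat)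
  ultimately show ?thesis
    by simp
qed

text \<open>Only one order of the factors is stated; the other is the instance at
  \<open>- L\<close>.\<close>

lemma block_unipotent_inverse:
  fixes L :: "'a::ring_1 mat"
  assumes "L \<in> carrier_mat n m"
  shows "inverts_mat (four_block_mat (1\<^sub>m n) L (0\<^sub>m m n) (1\<^sub>m m))
      (four_block_mat (1\<^sub>m n) (- L) (0\<^sub>m m n) (1\<^sub>m m))"
proof -
  have "- 0\<^sub>m m m + 1\<^sub>m m = (1\<^sub>m m :: 'a mat)"
    by auto
  then show ?thesis
    unfolding inverts_mat_def using assms
    by (subst mult_four_block_mat[of _ n n _ m _ m _ _ n _ m]) (auto simp: uminus_l_inv_mat[OF assms])
qed

lemma four_block_mat_inj:
  assumes "four_block_mat A B C D = four_block_mat A' B' C' D'"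
    and "A \<in> carrier_mat n m" "B \<in> carrier_mat n p" "D \<in> carrier_mat q p"
    and "A' \<in> carrier_mat n m" "B' \<in> carrier_mat n p" "D' \<in> carrier_mat q p"
  shows "B = B'"
proof (rule eq_matI)
  fix i j assume "i < dim_row B'" "j < dim_col B'"
  then show "B $$ (i, j) = B' $$ (i, j)"
    using arg_cong[OF assms(1), of "\<lambda>X. X $$ (i, m + j)"] assms(2-) by auto
qed (use assms in auto)

text \<open>This is the corner in \<open>block_conjugate\<close> for a scalar \<open>L\<close>: the
  difference of the two blocks magnified by \<open>c\<close>.\<close>

lemma smult_one_commutator:
  fixes c :: "'a::comm_ring_1"
  assumes "x \<in> carrier_mat n n" "y \<in> carrier_mat n n"
  shows "x * (c \<cdot>\<^sub>m 1\<^sub>m n) - (c \<cdot>\<^sub>m 1\<^sub>m n) * y = c \<cdot>\<^sub>m (x - y)"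
proof -
  have "x * (c \<cdot>\<^sub>m 1\<^sub>m n) = c \<cdot>\<^sub>m x" "(c \<cdot>\<^sub>m 1\<^sub>m n) * y = c \<cdot>\<^sub>m y"
    using assms mult_smult_distrib[OF assms(1) one_carrier_mat[of n], of c]
      mult_smult_assoc_mat[OF one_carrier_mat[of n] assms(2), of c] by simp_all
  then show ?thesis
    using assms by (auto simp: algebra_simps)
qed

text \<open>\<open>V\<close> is a neighbourhood on which the nc axioms hold. Boundedness is assumed
  near every point of \<open>V\<close>, because continuity at \<open>y\<close> is derived from a
  bound near y \<oplus> y.\<close>

locale locally_bounded_nc =
  fixes V :: "complex mat set" and f :: "complex mat \<Rightarrow> complex mat"
  assumes open_V: "freely_open V"
    and nc: "nc_function_on V f"
    and locally_bounded: "x \<in> V \<Longrightarrow> \<exists>W. freely_open W \<and> x \<in> W \<and> (\<exists>C. \<forall>y\<in>W. op_norm (f y) \<le> C)"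
begin

lemma dim_pos: "x \<in> V \<Longrightarrow> x \<in> carrier_mat n n \<Longrightarrow> 1 \<le> n"
  using freely_open_subset_nc_universe[OF open_V] by (auto simp: nc_universe_def)

lemma graded: "x \<in> V \<Longrightarrow> x \<in> carrier_mat n n \<Longrightarrow> f x \<in> carrier_mat n n"
  using nc dim_pos unfolding nc_function_on_def graded_on_def by blast

lemma nc_sum_in: "x \<in> V \<Longrightarrow> y \<in> V \<Longrightarrow> x \<oplus>\<^sub>d y \<in> V"
  using nc unfolding nc_function_on_def nc_set_def by blast

lemma f_nc_sum: "x \<in> V \<Longrightarrow> y \<in> V \<Longrightarrow> f (x \<oplus>\<^sub>d y) = f x \<oplus>\<^sub>d f y"
  using nc unfolding nc_function_on_def by blast

text \<open>Both matrices are direct sums conjugated by the same unipotent matrix, so the direct sum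
  axiom and the similarity axiom give the value. The last hypothesis is the demand of the similarity
  axiom that the conjugate stay in the domain.\<close>

lemma f_upper_block:
  assumes x: "x \<in> V" "x \<in> carrier_mat n n" and y: "y \<in> V" "y \<in> carrier_mat m m"
    and L: "L \<in> carrier_mat n m"
    and z: "four_block_mat x (x * L - L * y) (0\<^sub>m m n) y \<in> V"
  shows "f (four_block_mat x (x * L - L * y) (0\<^sub>m m n) y) =
    four_block_mat (f x) (f x * L - L * f y) (0\<^sub>m m n) (f y)"
proof -
  let ?s = "four_block_mat (1\<^sub>m n) L (0\<^sub>m m n) (1\<^sub>m m)"
  let ?t = "four_block_mat (1\<^sub>m n) (- L) (0\<^sub>m m n) (1\<^sub>m m)"
  have st: "inverts_mat ?s ?t" "inverts_mat ?t ?s"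
    using block_unipotent_inverse[of L n m] block_unipotent_inverse[of "- L" n m] L by auto
  have car: "?s \<in> carrier_mat (n + m) (n + m)" "?t \<in> carrier_mat (n + m) (n + m)"
      "x \<oplus>\<^sub>d y \<in> carrier_mat (n + m) (n + m)"
    using x y by (auto simp: nc_sum_def)
  have "1 \<le> n + m"
    using dim_pos[OF x] by simp
  then have "f (?t * (x \<oplus>\<^sub>d y) * ?s) = ?t * f (x \<oplus>\<^sub>d y) * ?s"
    using nc car st nc_sum_in[OF x(1) y(1)] z unfolding nc_function_on_def
    by (metis IntI block_conjugate[OF x(2) y(2) L])
  also have "f (x \<oplus>\<^sub>d y) = f x \<oplus>\<^sub>d f y"
    using x(1) y(1) by (rule f_nc_sum)
  finally show ?thesis
    unfolding block_conjugate[OF x(2) y(2) L] block_conjugate[OF graded[OF x] graded[OF y] L] .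
qed

text \<open>The corner x L - L y vanishes, so the conjugate is x \<oplus> y itself and lies in
  \<open>V\<close>; comparing the corners of its two values gives the claim. Since \<open>L\<close>
  may be rectangular or singular, this one rule yields the later relations between bidiagonal
  matrices.\<close>

lemma intertwine:
  assumes x: "x \<in> V" "x \<in> carrier_mat n n" and y: "y \<in> V" "y \<in> carrier_mat m m"
    and L: "L \<in> carrier_mat n m" and xL: "x * L = L * y"
  shows "f x * L = L * f y"
proof -
  note fx = graded[OF x] and fy = graded[OF y]
  have Ly: "L * y \<in> carrier_mat n m"
    using L y by auto
  have eq: "four_block_mat x (x * L - L * y) (0\<^sub>m m n) y = x \<oplus>\<^sub>d y"
    using x y Ly by (simp add: xL nc_sum_def minus_r_inv_mat)
  have "f (x \<oplus>\<^sub>d y) = four_block_mat (f x) (f x * L - L * f y) (0\<^sub>m m n) (f y)"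
    using f_upper_block[OF x y L] nc_sum_in[OF x(1) y(1)] by (simp add: eq)
  moreover have "f (x \<oplus>\<^sub>d y) = four_block_mat (f x) (0\<^sub>m n m) (0\<^sub>m m n) (f y)"
    using fx fy f_nc_sum[OF x(1) y(1)] by (simp add: nc_sum_def)
  ultimately have eq2: "four_block_mat (f x) (f x * L - L * f y) (0\<^sub>m m n) (f y) =
      four_block_mat (f x) (0\<^sub>m n m) (0\<^sub>m m n) (f y)"
    by simp
  have "f x * L - L * f y = 0\<^sub>m n m"
    by (rule four_block_mat_inj[OF eq2 fx _ fy fx _ fy]) (use fx fy L in auto)
  then have z: "(f x * L - L * f y) $$ (i, j) = 0" if "i < n" "j < m" for i j
    using that by simp
  show ?thesis
  proof (rule eq_matI)
    fix i j assume "i < dim_row (L * f y)" "j < dim_col (L * f y)"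
    then show "(f x * L) $$ (i, j) = (L * f y) $$ (i, j)"
      using z[of i j] fx fy L by (simp del: index_mult_mat(1))
  qed (use fx fy L in auto)
qed

text \<open>Apply \<open>f_upper_block\<close> with \<open>L = c I\<close>, where \<open>c \<rightarrow> \<infinity>\<close> slowly enough that
  \<open>c (M t - y)\<close> still tends to \<open>0\<close>: boundedness of \<open>f\<close> near \<open>y \<oplus> y\<close> bounds \<open>c (f (M t) - f y)\<close>.\<close>

lemma f_continuous:
  assumes M: "tends_entrywise n n M y F" and y: "y \<in> V" and ij: "i < n" "j < n"
  shows "((\<lambda>t. f (M t) $$ (i, j)) \<longlongrightarrow> f y $$ (i, j)) F"
proof -
  note Md = tends_entrywiseD[OF M]
  note yc = Md(2)
  note [simp] = Md(1,2)[THEN carrier_matD(1)] Md(1,2)[THEN carrier_matD(2)]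
  define d where "d t = (\<Sum>k<n. \<Sum>l<n. cmod (M t $$ (k, l) - y $$ (k, l)))" for t
  \<comment> \<open>With this choice the entries of c (M t - y) are at most
    \<open>sqrt (d t)\<close>, and a bound \<open>C\<close> on the magnified difference leaves
    \<open>C * sqrt (d t)\<close> for the original one; both tend to 0. Where
    \<open>d t = 0\<close>, the convention for the inverse of 0 gives
    \<open>c t = 0\<close>.\<close>
  define c where "c t = inverse (sqrt (d t))" for t
  define Z where "Z t = four_block_mat (M t) (M t * (complex_of_real (c t) \<cdot>\<^sub>m 1\<^sub>m n)
      - (complex_of_real (c t) \<cdot>\<^sub>m 1\<^sub>m n) * y) (0\<^sub>m n n) y" for t
  have dle: "cmod (M t $$ (k, l) - y $$ (k, l)) \<le> d t" if "k < n" "l < n" for t k l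
  proof -
    have "cmod (M t $$ (k, l) - y $$ (k, l)) \<le> (\<Sum>l<n. cmod (M t $$ (k, l) - y $$ (k, l)))"
      using that by (intro member_le_sum) auto
    also have "\<dots> \<le> d t"
      unfolding d_def using that by (intro member_le_sum[of k _ "\<lambda>k. \<Sum>l<n. cmod (M t $$ (k, l) - y $$ (k, l))"])
        (auto intro: sum_nonneg)
    finally show ?thesis .
  qed
  have d0: "0 \<le> d t" for t
    by (auto simp: d_def intro!: sum_nonneg)
  then have c0: "0 \<le> c t" for t
    by (simp add: c_def)
  have "((\<lambda>t. d t) \<longlongrightarrow> (\<Sum>k<n. \<Sum>l<n. cmod (y $$ (k, l) - y $$ (k, l)))) F"
    unfolding d_def by (intro tendsto_intros Md(3)) auto
  then have "((\<lambda>t. sqrt (d t)) \<longlongrightarrow> sqrt 0) F"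
    by (intro tendsto_real_sqrt) simp
  then have sqrtd: "((\<lambda>t. sqrt (d t)) \<longlongrightarrow> 0) F"
    by simp
  have Zij: "Z t $$ (k, l) = (if k < n then if l < n then M t $$ (k, l)
      else c t * (M t $$ (k, l - n) - y $$ (k, l - n)) else if l < n then 0 else y $$ (k - n, l - n))"
    if "k < n + n" "l < n + n" for t k l
    using that unfolding Z_def smult_one_commutator[OF Md(1) yc] by simp
  have "tends_entrywise (n + n) (n + n) Z (y \<oplus>\<^sub>d y) F"
  proof (rule tends_entrywiseI)
    fix k l assume kl: "k < n + n" "l < n + n"
    have small: "((\<lambda>t. c t * (M t $$ (k, l - n) - y $$ (k, l - n))) \<longlongrightarrow> 0) F" if "k < n"
    proof (rule tendsto_norm_zero_cancel, rule tendsto_sandwich[OF _ _ tendsto_const sqrtd])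
      have "norm (c t * (M t $$ (k, l - n) - y $$ (k, l - n))) \<le> sqrt (d t)" for t
      proof -
        have "l - n < n"
          using kl that by auto
        then have "norm (c t * (M t $$ (k, l - n) - y $$ (k, l - n))) \<le> c t * d t"
          using dle[OF that] c0[of t] by (simp add: norm_mult mult_left_mono)
        also have "\<dots> = sqrt (d t)"
          using real_div_sqrt[OF d0[of t]] by (simp add: c_def divide_inverse mult.commute)
        finally show ?thesis .
      qed
      then show "\<forall>\<^sub>F t in F. norm (c t * (M t $$ (k, l - n) - y $$ (k, l - n))) \<le> sqrt (d t)"
        by simp
    qed simp
    show "((\<lambda>t. Z t $$ (k, l)) \<longlongrightarrow> (y \<oplus>\<^sub>d y) $$ (k, l)) F"
      using small Md(3)[of k l] kl by (simp add: Zij nc_sum_def)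
  qed (simp_all add: Z_def nc_sum_def carrier_matI)
  note Zt = this
  obtain W C where W: "freely_open W" "y \<oplus>\<^sub>d y \<in> W" and C: "\<And>z. z \<in> W \<Longrightarrow> op_norm (f z) \<le> C"
    using locally_bounded[OF nc_sum_in[OF y y]] by blast
  have "\<forall>\<^sub>F t in F. M t \<in> V \<and> Z t \<in> V \<and> Z t \<in> W"
    using eventually_freely_open[OF M open_V y] eventually_freely_open[OF Zt open_V nc_sum_in[OF y y]]
      eventually_freely_open[OF Zt W] by eventually_elim simp
  then have "\<forall>\<^sub>F t in F. norm (f (M t) $$ (i, j) - f y $$ (i, j)) \<le> C * sqrt (d t)"
  proof eventually_elim
    case (elim t)
    note fM = graded[of "M t" n, OF _ Md(1)] and fy = graded[OF y yc]
    have fZ: "f (Z t) = four_block_mat (f (M t)) (f (M t) * (complex_of_real (c t) \<cdot>\<^sub>m 1\<^sub>m n)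
      - (complex_of_real (c t) \<cdot>\<^sub>m 1\<^sub>m n) * f y) (0\<^sub>m n n) (f y)"
      using elim y yc Md(1)[of t] unfolding Z_def by (intro f_upper_block) auto
    have "f (Z t) $$ (i, n + j) = c t * (f (M t) $$ (i, j) - f y $$ (i, j))"
      using fM fy elim ij unfolding fZ by (simp add: smult_one_commutator right_diff_distrib)
    moreover have "cmod (f (Z t) $$ (i, n + j)) \<le> op_norm (f (Z t))"
      using fM fy elim ij by (intro cmod_le_op_norm) (auto simp: fZ)
    ultimately have le: "c t * norm (f (M t) $$ (i, j) - f y $$ (i, j)) \<le> C"
      using C[of "Z t"] elim c0[of t] by (simp add: norm_mult)
    show ?case
    proof (cases "d t = 0")
      \<comment> \<open>Here \<open>c t = 0\<close>, so \<open>le\<close> carries no information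
        about the difference; but the two matrices coincide.\<close>
      case True
      then have "M t = y"
        using dle[of _ _ t] by (intro eq_matI) auto
      then show ?thesis
        using True by simp
    next
      case False
      then have "0 < sqrt (d t)"
        using d0[of t] by simp
      then show ?thesis
        using le by (simp add: c_def field_simps)
    qed
  qed
  moreover have "((\<lambda>t. C * sqrt (d t)) \<longlongrightarrow> 0) F"
    using tendsto_mult_left[OF sqrtd, of C] by simp
  ultimately have "((\<lambda>t. f (M t) $$ (i, j) - f y $$ (i, j)) \<longlongrightarrow> 0) F"
    by (rule Lim_null_comparison)
  then show ?thesis
    by (rule LIM_zero_cancel)
qed

end

section \<open>Newton expansion of nc-functions\<close>

text \<open>In the Newton basis \<open>\<Prod>i<j. (X - u i)\<close> rescaled by \<open>\<epsilon>\<^sup>j\<close>, this is multiplication by \<open>X\<close>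
  on polynomials modulo \<open>\<Prod>i\<le>m. (X - u i)\<close>.\<close>

definition newton_bidiag :: "nat \<Rightarrow> (nat \<Rightarrow> complex) \<Rightarrow> complex \<Rightarrow> complex mat" where
  "newton_bidiag m u \<epsilon> = mat (Suc m) (Suc m) (\<lambda>(i, j). if i = j then u i else if i = Suc j then \<epsilon> else 0)"

lemma newton_bidiag_carrier [simp]: "newton_bidiag m u \<epsilon> \<in> carrier_mat (Suc m) (Suc m)"
  by (simp add: newton_bidiag_def)

lemma newton_bidiag_dim [simp]:
  "dim_row (newton_bidiag m u \<epsilon>) = Suc m" "dim_col (newton_bidiag m u \<epsilon>) = Suc m"
  by (simp_all add: newton_bidiag_def)

lemma index_mult_mat_sum:
  assumes "A \<in> carrier_mat n k" "B \<in> carrier_mat k m" "i < n" "j < m"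
  shows "(A * B) $$ (i, j) = (\<Sum>l<k. A $$ (i, l) * B $$ (l, j))"
  using assms by (auto simp: scalar_prod_def atLeast0LessThan)

lemma index_newton_bidiag_mult:
  assumes A: "A \<in> carrier_mat (Suc m) n" and ij: "i \<le> m" "j < n"
  shows "(newton_bidiag m u \<epsilon> * A) $$ (i, j) =
    u i * A $$ (i, j) + (if i = 0 then 0 else \<epsilon> * A $$ (i - 1, j))"
proof -
  have "(newton_bidiag m u \<epsilon> * A) $$ (i, j) =
      (\<Sum>l<Suc m. newton_bidiag m u \<epsilon> $$ (i, l) * A $$ (l, j))"
    using ij by (intro index_mult_mat_sum[OF newton_bidiag_carrier A]) auto
  also have "\<dots> = (\<Sum>l<Suc m. (if l = i then u i * A $$ (i, j) else 0) +
      (if l = i - 1 then if i = 0 then 0 else \<epsilon> * A $$ (i - 1, j) else 0))"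
    using ij by (intro sum.cong) (auto simp: newton_bidiag_def)
  also have "\<dots> = u i * A $$ (i, j) + (if i = 0 then 0 else \<epsilon> * A $$ (i - 1, j))"
    using ij by (simp only: sum.distrib sum.delta) auto
  finally show ?thesis .
qed

lemma index_mult_newton_bidiag:
  assumes A: "A \<in> carrier_mat n (Suc m)" and ij: "i < n" "j \<le> m"
  shows "(A * newton_bidiag m u \<epsilon>) $$ (i, j) =
    A $$ (i, j) * u j + (if j = m then 0 else A $$ (i, Suc j) * \<epsilon>)"
proof -
  have "(A * newton_bidiag m u \<epsilon>) $$ (i, j) =
      (\<Sum>l<Suc m. A $$ (i, l) * newton_bidiag m u \<epsilon> $$ (l, j))"
    using ij by (intro index_mult_mat_sum[OF A newton_bidiag_carrier]) auto
  also have "\<dots> = (\<Sum>l<Suc m. (if l = j then A $$ (i, j) * u j else 0) +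
      (if l = Suc j then A $$ (i, Suc j) * \<epsilon> else 0))"
    using ij by (intro sum.cong) (auto simp: newton_bidiag_def)
  also have "\<dots> = A $$ (i, j) * u j + (if j = m then 0 else A $$ (i, Suc j) * \<epsilon>)"
    using ij by (simp only: sum.distrib sum.delta) auto
  finally show ?thesis .
qed

lemma newton_bidiag_Suc_zero:
  "newton_bidiag (Suc m) u 0 = newton_bidiag m u 0 \<oplus>\<^sub>d scalar_mat (u (Suc m))"
  by (rule eq_matI) (auto simp: newton_bidiag_def nc_sum_def less_Suc_eq)

lemma newton_bidiag_0: "newton_bidiag 0 u \<epsilon> = scalar_mat (u 0)"
  by (rule eq_matI) (auto simp: newton_bidiag_def)

section \<open>Newton basis polynomials evaluated at a matrix\<close>

primrec newton_mat :: "complex mat \<Rightarrow> (nat \<Rightarrow> complex) \<Rightarrow> nat \<Rightarrow> complex mat" where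
  "newton_mat x u 0 = 1\<^sub>m (dim_row x)"
| "newton_mat x u (Suc j) = newton_mat x u j * (x - u j \<cdot>\<^sub>m 1\<^sub>m (dim_row x))"

lemma newton_mat_carrier:
  assumes x: "x \<in> carrier_mat n n"
  shows "newton_mat x u j \<in> carrier_mat n n"
  using x by (induction j) (auto intro!: mult_carrier_mat minus_carrier_mat)

lemma minus_smult_one_mult:
  fixes x A :: "complex mat"
  assumes "x \<in> carrier_mat n n" "A \<in> carrier_mat n m"
  shows "(x - c \<cdot>\<^sub>m 1\<^sub>m n) * A = x * A - c \<cdot>\<^sub>m A"
  using assms by (simp add: minus_mult_distrib_mat[of _ n n _ _ m] mult_smult_assoc_mat[OF one_carrier_mat assms(2)])

lemma mult_minus_smult_one:
  fixes x A :: "complex mat"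
  assumes "x \<in> carrier_mat n n" "A \<in> carrier_mat m n"
  shows "A * (x - c \<cdot>\<^sub>m 1\<^sub>m n) = A * x - c \<cdot>\<^sub>m A"
  using assms by (simp add: mult_minus_distrib_mat[of _ m n _ n] mult_smult_distrib[OF assms(2) one_carrier_mat])

lemma newton_mat_commute:
  assumes x: "x \<in> carrier_mat n n"
  shows "x * newton_mat x u j = newton_mat x u j * x"
proof (induction j)
  case 0
  then show ?case
    using x by simp
next
  case (Suc j)
  let ?N = "newton_mat x u j" and ?y = "x - u j \<cdot>\<^sub>m 1\<^sub>m n"
  have N: "?N \<in> carrier_mat n n" and y: "?y \<in> carrier_mat n n"
    using newton_mat_carrier[OF x] x by auto
  have "x * ?y = ?y * x"
    using mult_minus_smult_one[OF x x] minus_smult_one_mult[OF x x] by simp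
  have "x * (?N * ?y) = x * ?N * ?y"
    using x N y by (simp add: assoc_mult_mat[of _ n n _ n _ n])
  also have "\<dots> = ?N * (x * ?y)"
    using x N y unfolding Suc by (simp add: assoc_mult_mat[of _ n n _ n _ n])
  also have "\<dots> = ?N * ?y * x"
    using x N y unfolding \<open>x * ?y = ?y * x\<close> by (simp add: assoc_mult_mat[of _ n n _ n _ n])
  finally show ?case
    using x by simp
qed

text \<open>In the Newton basis, multiplication by X sends N_j to N_(j+1) + u_j N_j, which is the
  column pattern of \<open>newton_bidiag\<close>. Commutation enters because
  \<open>newton_mat\<close> grows by factors on the right.\<close>

lemma index_mult_newton_mat:
  assumes x: "x \<in> carrier_mat n n" and ij: "i < n" "k < n"
  shows "(x * newton_mat x u j) $$ (i, k) =
    newton_mat x u (Suc j) $$ (i, k) + u j * newton_mat x u j $$ (i, k)"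
proof -
  note N = newton_mat_carrier[OF x, of u j]
  have "newton_mat x u (Suc j) = x * newton_mat x u j - u j \<cdot>\<^sub>m newton_mat x u j"
    using x N mult_minus_smult_one[OF x N, of "u j"] newton_mat_commute[OF x, of u j] by simp
  then show ?thesis
    using ij N x by (simp del: index_mult_mat(1) newton_mat.simps)
qed

section \<open>Values of nc-functions at bidiagonal matrices\<close>

context locally_bounded_nc
begin

text \<open>With off-diagonal entry 0 the matrix is a direct sum of 1 by 1 blocks, each of which
  lies in \<open>V\<close>.\<close>

lemma newton_bidiag_zero_in:
  assumes "\<And>i. i \<le> m \<Longrightarrow> u i \<in> level1 V"
  shows "newton_bidiag m u 0 \<in> V"
  using assms
proof (induction m)
  case 0
  then show ?case
    by (simp add: newton_bidiag_0 level1_def)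
next
  case (Suc m)
  then show ?case
    using nc_sum_in[of "newton_bidiag m u 0" "scalar_mat (u (Suc m))"]
    by (simp add: newton_bidiag_Suc_zero level1_def)
qed

lemma eventually_newton_bidiag_in:
  assumes "\<And>i. i \<le> m \<Longrightarrow> u i \<in> level1 V"
  shows "\<forall>\<^sub>F \<epsilon> in at 0. newton_bidiag m u \<epsilon> \<in> V"
proof (rule eventually_freely_open[OF tends_entrywiseI open_V newton_bidiag_zero_in[OF assms]])
  fix i j assume "i < Suc m" "j < Suc m"
  then show "((\<lambda>\<epsilon>. newton_bidiag m u \<epsilon> $$ (i, j)) \<longlongrightarrow> newton_bidiag m u 0 $$ (i, j)) (at 0)"
    by (cases "i = j"; cases "i = Suc j") (auto simp: newton_bidiag_def)
qed auto

text \<open>In the cases of interest this is \<epsilon>^m times the divided difference of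
  \<open>fun1 f\<close> at u 0, ..., u m. The parameter stays explicit because membership of the
  matrix in \<open>V\<close> is ensured only for small \<open>\<epsilon>\<close>.\<close>

definition nc_dd :: "nat \<Rightarrow> (nat \<Rightarrow> complex) \<Rightarrow> complex \<Rightarrow> complex" where
  "nc_dd m u \<epsilon> = f (newton_bidiag m u \<epsilon>) $$ (m, 0)"

lemma nc_dd_0: "nc_dd 0 u \<epsilon> = fun1 f (u 0)"
  by (simp add: nc_dd_def newton_bidiag_0 fun1_def)

lemma tends_newton_bidiag_upd:
  "tends_entrywise (Suc m) (Suc m) (\<lambda>\<mu>. newton_bidiag m (u(k := \<mu>)) \<epsilon>) (newton_bidiag m u \<epsilon>) (at (u k))"
proof (rule tends_entrywiseI)
  fix i j assume "i < Suc m" "j < Suc m"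
  then show "((\<lambda>\<mu>. newton_bidiag m (u(k := \<mu>)) \<epsilon> $$ (i, j)) \<longlongrightarrow> newton_bidiag m u \<epsilon> $$ (i, j)) (at (u k))"
    by (cases "i = k"; cases "i = j") (auto simp: newton_bidiag_def)
qed auto

lemma nc_dd_continuous:
  assumes "newton_bidiag m u \<epsilon> \<in> V"
  shows "((\<lambda>\<mu>. nc_dd m (u(k := \<mu>)) \<epsilon>) \<longlongrightarrow> nc_dd m u \<epsilon>) (at (u k))"
  unfolding nc_dd_def using f_continuous[OF tends_newton_bidiag_upd assms] by simp

text \<open>The diagonal matrix with entries r^i, where r is the quotient of the two parameters,
  intertwines the two bidiagonal matrices. This allows a switch to a parameter so small that
  auxiliary bidiagonal matrices lie in \<open>V\<close> as well.\<close>

lemma nc_dd_rescale: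
  assumes \<epsilon>: "newton_bidiag m u \<epsilon> \<in> V" and \<epsilon>': "newton_bidiag m u \<epsilon>' \<in> V" "\<epsilon>' \<noteq> 0"
  shows "nc_dd m u \<epsilon> = (\<epsilon> / \<epsilon>') ^ m * nc_dd m u \<epsilon>'"
proof -
  let ?T = "newton_bidiag m u \<epsilon>" and ?T' = "newton_bidiag m u \<epsilon>'"
  define r where "r = \<epsilon> / \<epsilon>'"
  have r: "r * \<epsilon>' = \<epsilon>"
    using \<epsilon>'(2) by (simp add: r_def)
  define S where "S = mat (Suc m) (Suc m) (\<lambda>(i, j). if i = j then r ^ i else 0)"
  have S: "S \<in> carrier_mat (Suc m) (Suc m)"
    by (simp add: S_def)
  have Sij: "S $$ (i, j) = (if i = j then r ^ i else 0)" if "i \<le> m" "j \<le> m" for i j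
    using that by (simp add: S_def)
  have "?T * S = S * ?T'"
  proof (rule eq_matI)
    fix i j assume "i < dim_row (S * ?T')" "j < dim_col (S * ?T')"
    then have ij: "i \<le> m" "j \<le> m" using S by auto
    have "(?T * S) $$ (i, j) = u i * S $$ (i, j) + (if i = 0 then 0 else \<epsilon> * S $$ (i - 1, j))"
      using ij by (intro index_newton_bidiag_mult[OF S]) auto
    also have "\<dots> = S $$ (i, j) * u j + (if j = m then 0 else S $$ (i, Suc j) * \<epsilon>')"
      using ij r by (cases "i = Suc j") (auto simp: Sij mult_ac)
    also have "\<dots> = (S * ?T') $$ (i, j)"
      using ij by (intro index_mult_newton_bidiag[OF S, symmetric]) auto
    finally show "(?T * S) $$ (i, j) = (S * ?T') $$ (i, j)" .
  qed (use S in auto)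
  then have eq: "f ?T * S = S * f ?T'"
    using \<epsilon> \<epsilon>' S by (intro intertwine) auto
  note fT = graded[OF \<epsilon> newton_bidiag_carrier] and fT' = graded[OF \<epsilon>'(1) newton_bidiag_carrier]
  have "(f ?T * S) $$ (m, 0) = (\<Sum>l<Suc m. if l = 0 then f ?T $$ (m, 0) else 0)"
    unfolding index_mult_mat_sum[OF fT S lessI zero_less_Suc] by (intro sum.cong) (auto simp: Sij)
  moreover have "(S * f ?T') $$ (m, 0) = (\<Sum>l<Suc m. if l = m then r ^ m * f ?T' $$ (m, 0) else 0)"
    unfolding index_mult_mat_sum[OF S fT' lessI zero_less_Suc] by (intro sum.cong) (auto simp: Sij)
  ultimately show ?thesis
    unfolding eq by (simp add: nc_dd_def r_def del: sum.lessThan_Suc)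
qed

text \<open>\<open>Q\<close> is the projection onto the first \<open>Suc k\<close> coordinates. It
  intertwines because a lower bidiagonal matrix never feeds later coordinates into earlier
  ones.\<close>

lemma f_newton_bidiag_truncate:
  assumes m: "newton_bidiag m u \<epsilon> \<in> V" and k: "newton_bidiag k u \<epsilon> \<in> V" and le: "i \<le> k" "k \<le> m"
  shows "f (newton_bidiag m u \<epsilon>) $$ (i, 0) = f (newton_bidiag k u \<epsilon>) $$ (i, 0)"
proof -
  let ?T = "newton_bidiag m u \<epsilon>" and ?T' = "newton_bidiag k u \<epsilon>"
  define Q where "Q = mat (Suc k) (Suc m) (\<lambda>(i, j). if i = j then 1 else 0 :: complex)"
  have Q: "Q \<in> carrier_mat (Suc k) (Suc m)"
    by (simp add: Q_def)
  have Qij: "Q $$ (i, j) = (if i = j then 1 else 0)" if "i \<le> k" "j \<le> m" for i j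
    using that by (simp add: Q_def)
  have "?T' * Q = Q * ?T"
  proof (rule eq_matI)
    fix i j assume "i < dim_row (Q * ?T)" "j < dim_col (Q * ?T)"
    then have ij: "i \<le> k" "j \<le> m" using Q by auto
    have "(?T' * Q) $$ (i, j) = u i * Q $$ (i, j) + (if i = 0 then 0 else \<epsilon> * Q $$ (i - 1, j))"
      using ij by (intro index_newton_bidiag_mult[OF Q]) auto
    also have "\<dots> = Q $$ (i, j) * u j + (if j = m then 0 else Q $$ (i, Suc j) * \<epsilon>)"
      using ij le by (cases "i = Suc j") (auto simp: Qij)
    also have "\<dots> = (Q * ?T) $$ (i, j)"
      using ij by (intro index_mult_newton_bidiag[OF Q, symmetric]) auto
    finally show "(?T' * Q) $$ (i, j) = (Q * ?T) $$ (i, j)" .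
  qed (use Q in auto)
  then have eq: "f ?T' * Q = Q * f ?T"
    using m k Q by (intro intertwine) auto
  note fT = graded[OF m newton_bidiag_carrier] and fT' = graded[OF k newton_bidiag_carrier]
  have i: "i < Suc k"
    using le by simp
  have "(f ?T' * Q) $$ (i, 0) = (\<Sum>l<Suc k. if l = 0 then f ?T' $$ (i, 0) else 0)"
    unfolding index_mult_mat_sum[OF fT' Q i zero_less_Suc] using le by (intro sum.cong) (auto simp: Qij)
  moreover have "(Q * f ?T) $$ (i, 0) = (\<Sum>l<Suc m. if l = i then f ?T $$ (i, 0) else 0)"
    unfolding index_mult_mat_sum[OF Q fT i zero_less_Suc] using i by (intro sum.cong) (auto simp: Qij)
  ultimately show ?thesis
    unfolding eq using le by (simp del: sum.lessThan_Suc)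
qed

text \<open>\<open>R\<close> is the inclusion of the span of all coordinates but the first, an
  invariant subspace on which the matrix acts with the nodes u 1, ..., u (m + 1).\<close>

lemma f_newton_bidiag_shift:
  assumes m: "newton_bidiag (Suc m) u \<epsilon> \<in> V" and k: "newton_bidiag m (u \<circ> Suc) \<epsilon> \<in> V"
  shows "f (newton_bidiag (Suc m) u \<epsilon>) $$ (Suc m, 1) = f (newton_bidiag m (u \<circ> Suc) \<epsilon>) $$ (m, 0)"
proof -
  let ?T = "newton_bidiag (Suc m) u \<epsilon>" and ?T' = "newton_bidiag m (u \<circ> Suc) \<epsilon>"
  define R where "R = mat (Suc (Suc m)) (Suc m) (\<lambda>(i, j). if i = Suc j then 1 else 0 :: complex)"
  have R: "R \<in> carrier_mat (Suc (Suc m)) (Suc m)"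
    by (simp add: R_def)
  have Rij: "R $$ (i, j) = (if i = Suc j then 1 else 0)" if "i \<le> Suc m" "j \<le> m" for i j
    using that by (simp add: R_def)
  have "?T * R = R * ?T'"
  proof (rule eq_matI)
    fix i j assume "i < dim_row (R * ?T')" "j < dim_col (R * ?T')"
    then have ij: "i \<le> Suc m" "j \<le> m" using R by auto
    have "(?T * R) $$ (i, j) = u i * R $$ (i, j) + (if i = 0 then 0 else \<epsilon> * R $$ (i - 1, j))"
      using ij by (intro index_newton_bidiag_mult[OF R]) auto
    also have "\<dots> = R $$ (i, j) * (u \<circ> Suc) j + (if j = m then 0 else R $$ (i, Suc j) * \<epsilon>)"
      using ij by (cases "i = Suc (Suc j)") (auto simp: Rij)
    also have "\<dots> = (R * ?T') $$ (i, j)"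
      using ij by (intro index_mult_newton_bidiag[OF R, symmetric]) auto
    finally show "(?T * R) $$ (i, j) = (R * ?T') $$ (i, j)" .
  qed (use R in auto)
  then have eq: "f ?T * R = R * f ?T'"
    using m k R by (intro intertwine) auto
  note fT = graded[OF m newton_bidiag_carrier] and fT' = graded[OF k newton_bidiag_carrier]
  have "(f ?T * R) $$ (Suc m, 0) = (\<Sum>l<Suc (Suc m). if l = 1 then f ?T $$ (Suc m, 1) else 0)"
    unfolding index_mult_mat_sum[OF fT R lessI zero_less_Suc] by (intro sum.cong) (auto simp: Rij)
  moreover have "(R * f ?T') $$ (Suc m, 0) = (\<Sum>l<Suc m. if l = m then f ?T' $$ (m, 0) else 0)"
    unfolding index_mult_mat_sum[OF R fT' lessI zero_less_Suc] by (intro sum.cong) (auto simp: Rij)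
  ultimately show ?thesis
    unfolding eq by (simp del: sum.lessThan_Suc)
qed

text \<open>Any point of \<open>V\<close> intertwines itself with itself, so \<open>?T\<close>
  commutes with \<open>f ?T\<close>. The bottom left entry of this relation involves its two
  neighbours in \<open>f ?T\<close>, which \<open>f_newton_bidiag_shift\<close> and
  \<open>f_newton_bidiag_truncate\<close> identify.\<close>

lemma nc_dd_recurrence:
  assumes m: "newton_bidiag (Suc m) u \<epsilon> \<in> V" and tail: "newton_bidiag m (u \<circ> Suc) \<epsilon> \<in> V"
    and init: "newton_bidiag m u \<epsilon> \<in> V"
  shows "(u (Suc m) - u 0) * nc_dd (Suc m) u \<epsilon> = \<epsilon> * (nc_dd m (u \<circ> Suc) \<epsilon> - nc_dd m u \<epsilon>)"
proof -
  let ?T = "newton_bidiag (Suc m) u \<epsilon>"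
  note fT = graded[OF m newton_bidiag_carrier]
  have "f ?T * ?T = ?T * f ?T"
    using m by (intro intertwine) auto
  then have "(f ?T * ?T) $$ (Suc m, 0) = (?T * f ?T) $$ (Suc m, 0)"
    by simp
  then have "f ?T $$ (Suc m, 0) * u 0 + f ?T $$ (Suc m, 1) * \<epsilon> =
      u (Suc m) * f ?T $$ (Suc m, 0) + \<epsilon> * f ?T $$ (m, 0)"
    using index_newton_bidiag_mult[OF fT, of "Suc m" 0 u \<epsilon>] index_mult_newton_bidiag[OF fT, of "Suc m" 0 u \<epsilon>]
    by simp
  then show ?thesis
    using f_newton_bidiag_shift[OF m tail] f_newton_bidiag_truncate[OF m init, of m]
    by (simp add: nc_dd_def algebra_simps)
qed

text \<open>Every \<open>v\<close> gives the intertwiner \<open>p \<mapsto> p(x) v\<close> from the bidiagonal matrix to \<open>x\<close>.\<close>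

lemma f_newton_expansion:
  assumes x: "x \<in> V" "x \<in> carrier_mat n n" and P: "newton_mat x u (Suc m) = 0\<^sub>m n n"
    and \<epsilon>: "\<epsilon> \<noteq> 0" "\<And>j. j \<le> m \<Longrightarrow> newton_bidiag j u \<epsilon> \<in> V" and ik: "i < n" "k < n"
  shows "f x $$ (i, k) = (\<Sum>j\<le>m. nc_dd j u \<epsilon> / \<epsilon> ^ j * newton_mat x u j $$ (i, k))"
proof -
  let ?T = "newton_bidiag m u \<epsilon>"
  \<comment> \<open>Column \<open>j\<close> is the j-th Newton polynomial of \<open>x\<close>
    applied to the basis vector with index \<open>k\<close>; dividing by \<epsilon>^j accounts for
    the scaling of the basis.\<close>
  define L where "L = mat n (Suc m) (\<lambda>(i, j). newton_mat x u j $$ (i, k) / \<epsilon> ^ j)"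
  have L: "L \<in> carrier_mat n (Suc m)"
    by (simp add: L_def)
  have T: "?T \<in> V"
    using \<epsilon>(2) by simp
  have "x * L = L * ?T"
  proof (rule eq_matI)
    fix i j assume "i < dim_row (L * ?T)" "j < dim_col (L * ?T)"
    then have ij: "i < n" "j \<le> m"
      using L by auto
    have "(x * L) $$ (i, j) = (\<Sum>l<n. x $$ (i, l) * newton_mat x u j $$ (l, k)) / \<epsilon> ^ j"
      using index_mult_mat_sum[OF x(2) L, of i j] ij by (simp add: L_def sum_divide_distrib)
    also have "\<dots> = (x * newton_mat x u j) $$ (i, k) / \<epsilon> ^ j"
      using index_mult_mat_sum[OF x(2) newton_mat_carrier[OF x(2)], of i k] ij ik by simp
    also have "\<dots> = (newton_mat x u (Suc j) $$ (i, k) + u j * newton_mat x u j $$ (i, k)) / \<epsilon> ^ j"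
      using index_mult_newton_mat[OF x(2) ij(1) ik(2)] by simp
    \<comment> \<open>For j = m the next Newton matrix vanishes by \<open>P\<close>, which matches
      the last column of \<open>?T\<close>, where no \<epsilon> occurs.\<close>
    also have "\<dots> = L $$ (i, j) * u j + (if j = m then 0 else L $$ (i, Suc j) * \<epsilon>)"
      using ij ik P \<epsilon>(1) by (auto simp: L_def field_simps simp del: newton_mat.simps)
    also have "\<dots> = (L * ?T) $$ (i, j)"
      using index_mult_newton_bidiag[OF L ij] by simp
    finally show "(x * L) $$ (i, j) = (L * ?T) $$ (i, j)" .
  qed (use x L in auto)
  then have eq: "f x * L = L * f ?T"
    using x T L by (intro intertwine) auto
  note fx = graded[OF x] and fT = graded[OF T newton_bidiag_carrier]
  \<comment> \<open>Column 0 of \<open>L\<close> is the basis vector with index \<open>k\<close>,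
    since the empty Newton product is the identity.\<close>
  have "(f x * L) $$ (i, 0) = (\<Sum>l<n. if l = k then f x $$ (i, k) else 0)"
    unfolding index_mult_mat_sum[OF fx L ik(1) zero_less_Suc] using ik x
    by (intro sum.cong) (auto simp: L_def)
  then have "f x $$ (i, k) = (f x * L) $$ (i, 0)"
    using ik by simp
  also have "\<dots> = (\<Sum>j<Suc m. L $$ (i, j) * f ?T $$ (j, 0))"
    unfolding eq by (rule index_mult_mat_sum[OF L fT ik(1) zero_less_Suc])
  also have "\<dots> = (\<Sum>j\<le>m. nc_dd j u \<epsilon> / \<epsilon> ^ j * newton_mat x u j $$ (i, k))"
    unfolding lessThan_Suc_atMost
  proof (intro sum.cong refl)
    fix j assume "j \<in> {..m}"
    then have j: "j \<le> m" by simp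
    then have "f ?T $$ (j, 0) = nc_dd j u \<epsilon>"
      unfolding nc_dd_def by (intro f_newton_bidiag_truncate T \<epsilon>(2)) auto
    then show "L $$ (i, j) * f ?T $$ (j, 0) = nc_dd j u \<epsilon> / \<epsilon> ^ j * newton_mat x u j $$ (i, k)"
      using ik j by (simp add: L_def)
  qed
  finally show ?thesis .
qed

end

section \<open>Newton expansion of the resolvent\<close>

text \<open>Each factor B - u j adds one zero column: its columns k \<le> j vanish from row j
  downward, because \<open>B\<close> is triangular and its j-th diagonal entry is cancelled, while
  the columns l < j of the previous product vanish already.\<close>

lemma newton_mat_upper_triangular:
  assumes B: "B \<in> carrier_mat n n" "upper_triangular B" and d: "\<And>i. i < n \<Longrightarrow> B $$ (i, i) = u i"
    and "i < n" "k < j" "j \<le> n"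
  shows "newton_mat B u j $$ (i, k) = 0"
  using assms(4-)
proof (induction j arbitrary: i k)
  case (Suc j)
  let ?C = "B - u j \<cdot>\<^sub>m 1\<^sub>m n"
  note N = newton_mat_carrier[OF B(1), of u j]
  have C: "?C \<in> carrier_mat n n"
    using B by auto
  have k: "k < n"
    using Suc.prems by simp
  have "newton_mat B u (Suc j) $$ (i, k) = (\<Sum>l<n. newton_mat B u j $$ (i, l) * ?C $$ (l, k))"
    using index_mult_mat_sum[OF N C Suc.prems(1) k] B by simp
  also have "\<dots> = 0"
  proof (intro sum.neutral ballI)
    fix l assume "l \<in> {..<n}"
    then have l: "l < n" by simp
    show "newton_mat B u j $$ (i, l) * ?C $$ (l, k) = 0"
    proof (cases "l < j")
      case True
      then show ?thesis
        using Suc.IH[of i l] Suc.prems by simp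
    next
      case False
      have "?C $$ (l, k) = 0"
      proof (cases "l = k")
        case True
        then have "k = j"
          using False Suc.prems by simp
        then show ?thesis
          using True l d[of j] B by simp
      next
        case False
        then have "k < l"
          using \<open>\<not> l < j\<close> Suc.prems by simp
        then show ?thesis
          using l k B by (simp add: upper_triangularD)
      qed
      then show ?thesis by simp
    qed
  qed
  finally show ?case .
qed simp

lemma newton_mat_similar:
  assumes x: "x \<in> carrier_mat n n" and B: "B \<in> carrier_mat n n" and P: "P \<in> carrier_mat n n"
    and eq: "x * P = P * B"
  shows "newton_mat x u j * P = P * newton_mat B u j"
proof (induction j)
  case 0
  then show ?case
    using x B P by simp
next
  case (Suc j)
  let ?X = "x - u j \<cdot>\<^sub>m 1\<^sub>m n" and ?B = "B - u j \<cdot>\<^sub>m 1\<^sub>m n"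
  note N = newton_mat_carrier[OF x, of u j] and NB = newton_mat_carrier[OF B, of u j]
  have X: "?X \<in> carrier_mat n n" and C: "?B \<in> carrier_mat n n"
    using x B by auto
  have XP: "?X * P = P * ?B"
    using minus_smult_one_mult[OF x P] mult_minus_smult_one[OF B P] eq by simp
  have "newton_mat x u j * ?X * P = newton_mat x u j * P * ?B"
    using N X P C XP by (simp add: assoc_mult_mat[of _ n n _ n _ n])
  also have "\<dots> = P * (newton_mat B u j * ?B)"
    using NB P C unfolding Suc by (simp add: assoc_mult_mat[of _ n n _ n _ n])
  finally show ?case
    using x B by simp
qed

text \<open>The Cayley-Hamilton theorem, with the nodes in the order of the diagonal of a Schur
  triangularization: the product vanishes for the triangular matrix and hence, by similarity, for
  \<open>x\<close>.\<close>

lemma newton_mat_spectrum_eq_zero: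
  assumes x: "x \<in> carrier_mat n n"
  shows "\<exists>u. (\<forall>i<n. u i \<in> spectrum x) \<and> newton_mat x u n = 0\<^sub>m n n"
proof -
  obtain as where as: "char_poly x = (\<Prod>a\<leftarrow>as. [:- a, 1:])" "length as = n"
    using char_poly_factorized[OF x] by blast
  obtain B P Q where "schur_decomposition x as = (B, P, Q)"
    by (cases "schur_decomposition x as") auto
  from schur_decomposition[OF x as(1) this]
  have sim: "similar_mat_wit x B P Q" and ut: "upper_triangular B" and diag: "diag_mat B = as"
    by auto
  note w = similar_mat_witD2[OF x sim]
  define u where "u i = as ! i" for i
  have "u i \<in> spectrum x" if "i < n" for i
    using that as linear_poly_root[of "as ! i" as] by (simp add: u_def spectrum_root_char_poly[OF x])
  moreover have "newton_mat x u n = 0\<^sub>m n n"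
  proof -
    note N = newton_mat_carrier[OF x, of u n] and NB = newton_mat_carrier[OF w(5), of u n]
    have "B $$ (i, i) = u i" if "i < n" for i
      using that diag w(5) by (auto simp: u_def diag_mat_def)
    then have "newton_mat B u n = 0\<^sub>m n n"
      using newton_mat_upper_triangular[OF w(5) ut] NB by (intro eq_matI) auto
    moreover have "x * P = P * B"
    proof -
      have "x * P = P * B * (Q * P)"
        using w by (simp add: assoc_mult_mat[of _ n n _ n _ n])
      then show ?thesis
        using w by simp
    qed
    ultimately have "newton_mat x u n * P = 0\<^sub>m n n"
      using newton_mat_similar[OF x w(5,6)] w by simp
    then have "newton_mat x u n * P * Q = 0\<^sub>m n n"
      using w by simp
    then show ?thesis
      using N w by (simp add: assoc_mult_mat[of _ n n _ n _ n])
  qed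
  ultimately show ?thesis
    by blast
qed

text \<open>The sum telescopes when multiplied by \<open>z - x\<close>.\<close>

lemma resolvent_newton:
  assumes x: "x \<in> carrier_mat n n" and P: "newton_mat x u (Suc m) = 0\<^sub>m n n"
    and z: "\<And>i. i \<le> m \<Longrightarrow> z \<noteq> u i" and ab: "a < n" "b < n"
  shows "resolvent x z $$ (a, b) = (\<Sum>j\<le>m. newton_mat x u j $$ (a, b) / (\<Prod>i\<le>j. z - u i))"
proof -
  define N where "N j = newton_mat x u j" for j
  define w where "w j = (\<Prod>i<j. z - u i)" for j
  have N: "N j \<in> carrier_mat n n" for j
    unfolding N_def by (rule newton_mat_carrier[OF x])
  define A where "A = z \<cdot>\<^sub>m 1\<^sub>m n - x"
  define R where "R = mat n n (\<lambda>(a, b). \<Sum>j\<le>m. N j $$ (a, b) / w (Suc j))"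
  have A: "A \<in> carrier_mat n n" and R: "R \<in> carrier_mat n n"
    using x by (auto simp: A_def R_def)
  have w: "w j \<noteq> 0" if "j \<le> Suc m" for j
    using z that by (auto simp: w_def)
  have "A * R = 1\<^sub>m n"
  proof (rule eq_matI)
    fix a b assume "a < dim_row (1\<^sub>m n :: complex mat)" "b < dim_col (1\<^sub>m n :: complex mat)"
    then have ab: "a < n" "b < n" by auto
    have AN: "(\<Sum>l<n. A $$ (a, l) * N j $$ (l, b)) = (z - u j) * N j $$ (a, b) - N (Suc j) $$ (a, b)" for j
    proof -
      have "(\<Sum>l<n. A $$ (a, l) * N j $$ (l, b)) = (A * N j) $$ (a, b)"
        by (rule index_mult_mat_sum[OF A N ab, symmetric])
      also have "A * N j = z \<cdot>\<^sub>m N j - x * N j"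
        using x N[of j] unfolding A_def
        by (simp add: minus_mult_distrib_mat[of _ n n _ _ n] mult_smult_assoc_mat[OF one_carrier_mat N])
      also have "\<dots> $$ (a, b) = z * N j $$ (a, b) - (x * N j) $$ (a, b)"
        using ab x N[of j] by (simp del: index_mult_mat(1))
      also have "(x * N j) $$ (a, b) = N (Suc j) $$ (a, b) + u j * N j $$ (a, b)"
        unfolding N_def by (rule index_mult_newton_mat[OF x ab])
      finally show ?thesis
        by (simp add: algebra_simps)
    qed
    have "(A * R) $$ (a, b) = (\<Sum>l<n. A $$ (a, l) * (\<Sum>j\<le>m. N j $$ (l, b) / w (Suc j)))"
      unfolding index_mult_mat_sum[OF A R ab] using ab by (intro sum.cong) (auto simp: R_def)
    also have "\<dots> = (\<Sum>j\<le>m. \<Sum>l<n. A $$ (a, l) * N j $$ (l, b) / w (Suc j))"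
      unfolding sum_distrib_left by (subst sum.swap) simp
    also have "\<dots> = (\<Sum>j\<le>m. ((z - u j) * N j $$ (a, b) - N (Suc j) $$ (a, b)) / w (Suc j))"
      by (simp add: sum_divide_distrib[symmetric] AN)
    also have "\<dots> = (\<Sum>j<Suc m. N j $$ (a, b) / w j - N (Suc j) $$ (a, b) / w (Suc j))"
      unfolding lessThan_Suc_atMost
    proof (intro sum.cong refl)
      fix j assume "j \<in> {..m}"
      then have "z - u j \<noteq> 0" "w (Suc j) = w j * (z - u j)"
        using z[of j] by (auto simp: w_def)
      then show "((z - u j) * N j $$ (a, b) - N (Suc j) $$ (a, b)) / w (Suc j) =
          N j $$ (a, b) / w j - N (Suc j) $$ (a, b) / w (Suc j)"
        by (simp add: diff_divide_distrib)
    qed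
    also have "\<dots> = N 0 $$ (a, b) / w 0 - N (Suc m) $$ (a, b) / w (Suc m)"
      by (rule sum_lessThan_telescope')
    also have "\<dots> = 1\<^sub>m n $$ (a, b)"
      using ab x P by (simp add: N_def w_def)
    finally show "(A * R) $$ (a, b) = 1\<^sub>m n $$ (a, b)" .
  qed (use A R in auto)
  have RA: "R * A = 1\<^sub>m n"
    by (rule mat_mult_left_right_inverse[OF A R \<open>A * R = 1\<^sub>m n\<close>])
  \<comment> \<open>The resolvent is defined through \<open>mat_inverse\<close>. The inverse
    \<open>R\<close> excludes the outcome \<open>None\<close>, and uniqueness of inverses identifies
    any other outcome with \<open>R\<close>.\<close>
  have "mat_inverse A = Some R"
  proof (cases "mat_inverse A")
    case None
    have "A \<in> Units (ring_mat TYPE(complex) n ())"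
      unfolding Units_def using A R RA \<open>A * R = 1\<^sub>m n\<close> by (auto simp: ring_mat_def)
    then show ?thesis
      using mat_inverse(1)[OF A None, of "()"] by contradiction
  next
    case (Some B)
    from mat_inverse(2)[OF A Some] have B: "B * A = 1\<^sub>m n" "B \<in> carrier_mat n n"
      by auto
    have "B = B * (A * R)"
      using B \<open>A * R = 1\<^sub>m n\<close> by simp
    also have "\<dots> = B * A * R"
      by (rule assoc_mult_mat[OF B(2) A R, symmetric])
    also have "\<dots> = R"
      using B R by simp
    finally show ?thesis
      using Some by simp
  qed
  then have "resolvent x z = R"
    using x by (simp add: resolvent_def A_def)
  then show ?thesis
    using ab by (simp add: R_def N_def w_def lessThan_Suc_atMost)
qed

section \<open>Divided differences as cycle integrals\<close>

text \<open>One circle of a common small radius is drawn around each point of \<open>K\<close>, its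
  closed disc lying in \<open>S\<close> and containing no other point of \<open>K\<close>. This
  makes the choice in \<open>riesz_calculus\<close> meaningful.\<close>

lemma surrounds_in_exists:
  assumes K: "finite K" and S: "open S" "K \<subseteq> S"
  shows "\<exists>\<Gamma>. surrounds_in \<Gamma> K S"
proof -
  obtain r where r: "r > 0" and sub: "\<And>k. k \<in> K \<Longrightarrow> cball k r \<subseteq> S"
    and sep: "\<And>k l. k \<in> K \<Longrightarrow> l \<in> K \<Longrightarrow> l \<noteq> k \<Longrightarrow> l \<notin> cball k r"
  proof -
    have "\<forall>\<^sub>F r in at_right 0. cball k r \<subseteq> S \<and> (\<forall>l\<in>K. l \<noteq> k \<longrightarrow> l \<notin> cball k r)" if k: "k \<in> K" for k
    proof -
      have "open (S - (K - {k}))" "k \<in> S - (K - {k})"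
        using S K k by (auto intro!: open_Diff finite_imp_closed)
      then obtain e where e: "e > 0" "cball k e \<subseteq> S - (K - {k})"
        using open_contains_cball by blast
      have "\<forall>\<^sub>F r in at_right 0. r < e"
        using e(1) by (rule eventually_at_right_less[THEN eventually_mono, rotated] order_tendstoD(2)[OF tendsto_ident_at])
      then show ?thesis
      proof eventually_elim
        case (elim r)
        then have "cball k r \<subseteq> cball k e"
          by (auto simp: subset_cball)
        then show ?case
          using e(2) by blast
      qed
    qed
    then have "\<forall>\<^sub>F r in at_right 0. \<forall>k\<in>K. cball k r \<subseteq> S \<and> (\<forall>l\<in>K. l \<noteq> k \<longrightarrow> l \<notin> cball k r)"
      using K by (simp add: eventually_ball_finite)
    then have "\<forall>\<^sub>F r in at_right (0::real). 0 < r \<and> (\<forall>k\<in>K. cball k r \<subseteq> S \<and> (\<forall>l\<in>K. l \<noteq> k \<longrightarrow> l \<notin> cball k r))"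
      using eventually_at_right_less by eventually_elim auto
    then have "\<exists>r>0. \<forall>k\<in>K. cball k r \<subseteq> S \<and> (\<forall>l\<in>K. l \<noteq> k \<longrightarrow> l \<notin> cball k r)"
      by (intro eventually_happens'[OF trivial_limit_at_right_real])
    then obtain r where "r > 0" "\<forall>k\<in>K. cball k r \<subseteq> S \<and> (\<forall>l\<in>K. l \<noteq> k \<longrightarrow> l \<notin> cball k r)"
      by auto
    then show ?thesis
      by (intro that[of r]) blast+
  qed
  obtain ks where ks: "set ks = K" "distinct ks"
    using finite_distinct_list[OF K] by blast
  define \<Gamma> where "\<Gamma> = map (\<lambda>k. circlepath k r) ks"
  have winding: "(\<Sum>\<gamma>\<leftarrow>\<Gamma>. winding_number \<gamma> w) = (\<Sum>k\<in>K. winding_number (circlepath k r) w)" for w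
    using ks by (simp add: \<Gamma>_def sum_list_distinct_conv_sum_set o_def)
  have out: "winding_number (circlepath k r) w = 0" if "w \<notin> cball k r" for k w
    using that r by (intro winding_number_zero_outside[of _ "cball k r"]) (auto simp: sphere_def)
  have "surrounds_in \<Gamma> K S"
    unfolding surrounds_in_def winding
  proof (intro conjI ballI allI impI)
    fix \<gamma> assume "\<gamma> \<in> set \<Gamma>"
    then obtain k where k: "k \<in> K" "\<gamma> = circlepath k r"
      using ks by (auto simp: \<Gamma>_def)
    have "l \<notin> sphere k r" if "l \<in> K" for l
      using sep[OF k(1) that] r by (cases "l = k") (auto simp: sphere_def)
    moreover have "sphere k r \<subseteq> S"
      using sub[OF k(1)] by (auto simp: sphere_def cball_def)
    ultimately show "path_image \<gamma> \<subseteq> S - K"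
      using k r by auto
    show "valid_path \<gamma>" "pathfinish \<gamma> = pathstart \<gamma>"
      using k by auto
  next
    fix w assume w: "w \<in> K"
    have "(\<Sum>k\<in>K. winding_number (circlepath k r) w) = (\<Sum>k\<in>K. if k = w then 1 else 0)"
      using w sep out r by (intro sum.cong) (auto simp: winding_number_circlepath)
    then show "(\<Sum>k\<in>K. winding_number (circlepath k r) w) = 1"
      using w K by simp
  next
    fix w assume "w \<notin> S"
    then show "(\<Sum>k\<in>K. winding_number (circlepath k r) w) = 0"
      using sub out by (intro sum.neutral) blast
  qed
  then show ?thesis
    by blast
qed

text \<open>The integrands converge uniformly on a neighbourhood of the path, as \<open>w\<close>
  keeps a positive distance from it.\<close>

lemma tendsto_Cauchy_type_integral:
  assumes S: "open S" and G: "G holomorphic_on S" and \<gamma>: "valid_path \<gamma>" "path_image \<gamma> \<subseteq> S"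
    and w: "w \<notin> path_image \<gamma>"
  shows "((\<lambda>\<mu>. contour_integral \<gamma> (\<lambda>z. G z / (z - \<mu>))) \<longlongrightarrow> contour_integral \<gamma> (\<lambda>z. G z / (z - w))) (at w)"
proof -
  have cmp: "compact (path_image \<gamma>)" and ne: "path_image \<gamma> \<noteq> {}"
    using \<gamma> by (auto simp: compact_valid_path_image)
  obtain \<delta> where \<delta>: "0 < \<delta>" "\<And>z. z \<in> path_image \<gamma> \<Longrightarrow> \<delta> \<le> dist w z"
    using separate_point_closed[OF compact_imp_closed[OF cmp] w] by blast
  have contG: "continuous_on S G"
    using G by (rule holomorphic_on_imp_continuous_on)
  then have "compact (G ` path_image \<gamma>)"
    using cmp \<gamma>(2) compact_continuous_image continuous_on_subset by blast
  then obtain B where B: "\<And>z. z \<in> path_image \<gamma> \<Longrightarrow> norm (G z) \<le> B"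
    by (metis bounded_iff compact_imp_bounded imageI)
  \<comment> \<open>The estimate for contour integrals asks for a bound on an open set around the
    path. On \<open>T\<close> the numerator is below \<open>B + 1\<close> and the distance to
    \<open>w\<close> exceeds \<delta> / 2, so the distance to \<mu> exceeds \<delta> / 4 once \<mu>
    is within \<delta> / 4 of \<open>w\<close>.\<close>
  define T where "T = S \<inter> G -` ball 0 (B + 1) \<inter> - cball w (\<delta> / 2)"
  have T: "open T"
    unfolding T_def using contG S by (intro open_Int continuous_open_preimage) auto
  have \<gamma>T: "path_image \<gamma> \<subseteq> T"
  proof
    fix z assume z: "z \<in> path_image \<gamma>"
    then show "z \<in> T"
      using \<gamma>(2) B[OF z] \<delta>(2)[OF z] \<delta>(1) by (auto simp: T_def)
  qed
  obtain L where L: "0 < L"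
    and bound: "\<And>h B. h holomorphic_on T \<Longrightarrow> (\<And>z. z \<in> T \<Longrightarrow> norm (h z) \<le> B) \<Longrightarrow>
      norm (contour_integral \<gamma> h) \<le> L * B"
    using contour_integral_bound_exists[OF T \<gamma>(1) \<gamma>T] by blast
  have near: "\<forall>\<^sub>F \<mu> in at w. dist \<mu> w < \<delta> / 4"
    using \<delta>(1) by (auto simp: eventually_at intro!: exI[of _ "\<delta> / 4"])
  have "\<forall>\<^sub>F \<mu> in at w. norm (contour_integral \<gamma> (\<lambda>z. G z / (z - \<mu>)) - contour_integral \<gamma> (\<lambda>z. G z / (z - w)))
      \<le> L * ((B + 1) * dist \<mu> w * (4 / \<delta>) * (2 / \<delta>))"
    using near
  proof eventually_elim
    case (elim \<mu>)
    have GT: "G holomorphic_on T"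
      using G by (rule holomorphic_on_subset) (auto simp: T_def)
    have far: "\<delta> / 2 < norm (z - w)" "\<delta> / 4 < norm (z - \<mu>)" if "z \<in> T" for z
    proof -
      show far: "\<delta> / 2 < norm (z - w)"
        using that by (auto simp: T_def dist_norm norm_minus_commute)
      have "norm (z - w) \<le> norm (z - \<mu>) + norm (\<mu> - w)"
        by (metis diff_add_cancel add_diff_eq norm_triangle_ineq)
      then show "\<delta> / 4 < norm (z - \<mu>)"
        using far elim by (simp add: dist_norm)
    qed
    have nz: "z - w \<noteq> 0" "z - \<mu> \<noteq> 0" if "z \<in> T" for z
      using far[OF that] \<delta>(1) by auto
    have h: "(\<lambda>z. G z / (z - \<mu>)) holomorphic_on T" "(\<lambda>z. G z / (z - w)) holomorphic_on T"
      using nz by (auto intro!: holomorphic_intros GT)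
    have "norm (G z / (z - \<mu>) - G z / (z - w)) \<le> (B + 1) * dist \<mu> w * (4 / \<delta>) * (2 / \<delta>)" if z: "z \<in> T" for z
    proof -
      have "G z / (z - \<mu>) - G z / (z - w) = G z * (\<mu> - w) * inverse (z - \<mu>) * inverse (z - w)"
        using nz[OF z] by (simp add: field_simps)
      then have eq: "norm (G z / (z - \<mu>) - G z / (z - w)) =
          norm (G z) * dist \<mu> w * inverse (norm (z - \<mu>)) * inverse (norm (z - w))"
        by (simp add: norm_mult norm_inverse dist_norm)
      have GB: "norm (G z) \<le> B + 1"
        using z by (auto simp: T_def)
      then have B1: "0 \<le> B + 1"
        using norm_ge_zero order_trans by blast
      note eq
      also have "norm (G z) * dist \<mu> w * inverse (norm (z - \<mu>)) * inverse (norm (z - w)) \<le>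
          (B + 1) * dist \<mu> w * inverse (\<delta> / 4) * inverse (\<delta> / 2)"
        using far[OF z] \<delta>(1) GB B1 by (intro mult_mono le_imp_inverse_le) auto
      finally show ?thesis
        by simp
    qed
    then have "norm (contour_integral \<gamma> (\<lambda>z. G z / (z - \<mu>) - G z / (z - w))) \<le>
        L * ((B + 1) * dist \<mu> w * (4 / \<delta>) * (2 / \<delta>))"
      using h by (intro bound holomorphic_on_diff) auto
    then show ?case
      using contour_integrable_holomorphic_simple[OF h(1) T \<gamma>(1) \<gamma>T]
        contour_integrable_holomorphic_simple[OF h(2) T \<gamma>(1) \<gamma>T]
      by (simp add: contour_integral_diff)
  qed
  moreover have "((\<lambda>\<mu>. L * ((B + 1) * dist \<mu> w * (4 / \<delta>) * (2 / \<delta>))) \<longlongrightarrow>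
      L * ((B + 1) * dist w w * (4 / \<delta>) * (2 / \<delta>))) (at w)"
    by (intro tendsto_intros)
  then have "((\<lambda>\<mu>. L * ((B + 1) * dist \<mu> w * (4 / \<delta>) * (2 / \<delta>))) \<longlongrightarrow> 0) (at w)"
    by simp
  ultimately show ?thesis
    by (rule Lim_null_comparison[THEN LIM_zero_cancel])
qed

section \<open>Integrals over cycles\<close>

definition cycle_integral :: "(real \<Rightarrow> complex) list \<Rightarrow> (complex \<Rightarrow> complex) \<Rightarrow> complex" where
  "cycle_integral \<Gamma> h = 1 / (2 * of_real pi * \<i>) * (\<Sum>\<gamma>\<leftarrow>\<Gamma>. contour_integral \<gamma> h)"

text \<open>The contour form of the divided difference of \<open>g\<close>, which makes sense for
  repeated nodes too. It has the usual meaning when the total index is one at every node.\<close>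

definition divided_difference ::
    "(real \<Rightarrow> complex) list \<Rightarrow> (complex \<Rightarrow> complex) \<Rightarrow> nat \<Rightarrow> (nat \<Rightarrow> complex) \<Rightarrow> complex" where
  "divided_difference \<Gamma> g m u = cycle_integral \<Gamma> (\<lambda>z. g z / (\<Prod>i\<le>m. z - u i))"

lemma cycle_integral_cong:
  assumes "\<And>\<gamma> z. \<gamma> \<in> set \<Gamma> \<Longrightarrow> z \<in> path_image \<gamma> \<Longrightarrow> h z = h' z"
  shows "cycle_integral \<Gamma> h = cycle_integral \<Gamma> h'"
proof -
  have "map (\<lambda>\<gamma>. contour_integral \<gamma> h) \<Gamma> = map (\<lambda>\<gamma>. contour_integral \<gamma> h') \<Gamma>"
    using assms by (auto intro!: contour_integral_eq)
  then show ?thesis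
    by (simp only: cycle_integral_def)
qed

locale null_homologous_cycle =
  fixes \<Gamma> :: "(real \<Rightarrow> complex) list" and S :: "complex set"
  assumes S: "open S"
    and \<Gamma>: "\<gamma> \<in> set \<Gamma> \<Longrightarrow> valid_path \<gamma>" "\<gamma> \<in> set \<Gamma> \<Longrightarrow> pathfinish \<gamma> = pathstart \<gamma>"
      "\<gamma> \<in> set \<Gamma> \<Longrightarrow> path_image \<gamma> \<subseteq> S"
    and null: "w \<notin> S \<Longrightarrow> (\<Sum>\<gamma>\<leftarrow>\<Gamma>. winding_number \<gamma> w) = 0"
begin

text \<open>The condition is open, unlike membership in a finite spectrum, so nodes may be moved
  within it when passing to a limit.\<close>

definition index_one :: "complex set" where
  "index_one = {w. (\<forall>\<gamma>\<in>set \<Gamma>. w \<notin> path_image \<gamma>) \<and> (\<Sum>\<gamma>\<leftarrow>\<Gamma>. winding_number \<gamma> w) = 1}"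

lemma open_index_one: "open index_one"
proof (subst open_subopen, safe)
  fix w assume w: "w \<in> index_one"
  have "\<forall>\<^sub>F v in nhds w. \<forall>\<gamma>\<in>set \<Gamma>. v \<notin> path_image \<gamma> \<and> winding_number \<gamma> v = winding_number \<gamma> w"
    by (rule eventually_winding_numbers_eq) (use \<Gamma>(1)[THEN valid_path_imp_path] \<Gamma>(2) w in \<open>auto simp: index_one_def\<close>)
  then have "\<forall>\<^sub>F v in nhds w. v \<in> index_one"
  proof eventually_elim
    case (elim v)
    then have "map (\<lambda>\<gamma>. winding_number \<gamma> v) \<Gamma> = map (\<lambda>\<gamma>. winding_number \<gamma> w) \<Gamma>"
      by auto
    then have "(\<Sum>\<gamma>\<leftarrow>\<Gamma>. winding_number \<gamma> v) = (\<Sum>\<gamma>\<leftarrow>\<Gamma>. winding_number \<gamma> w)"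
      by (simp only:)
    then show ?case
      using elim w by (simp add: index_one_def)
  qed
  then show "\<exists>T. open T \<and> w \<in> T \<and> T \<subseteq> index_one"
    by (auto simp: eventually_nhds)
qed

lemma cycle_integral_holomorphic:
  assumes "h holomorphic_on S"
  shows "cycle_integral \<Gamma> h = 0"
proof -
  \<comment> \<open>Positions in the list serve as indices, since the same path may occur in it
    several times.\<close>
  have "(\<Sum>i<length \<Gamma>. contour_integral (\<Gamma> ! i) h) = 0"
    using \<Gamma> null
    by (intro Cauchy_theorem_cycle[OF S assms]) (auto simp: sum_list_sum_nth atLeast0LessThan)
  then show ?thesis
    by (simp add: cycle_integral_def sum_list_sum_nth atLeast0LessThan)
qed

lemma cycle_integral_add:
  assumes "open T" "\<And>\<gamma>. \<gamma> \<in> set \<Gamma> \<Longrightarrow> path_image \<gamma> \<subseteq> T" "h holomorphic_on T" "k holomorphic_on T"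
  shows "cycle_integral \<Gamma> (\<lambda>z. h z + k z) = cycle_integral \<Gamma> h + cycle_integral \<Gamma> k"
proof -
  have "map (\<lambda>\<gamma>. contour_integral \<gamma> (\<lambda>z. h z + k z)) \<Gamma> =
      map (\<lambda>\<gamma>. contour_integral \<gamma> h + contour_integral \<gamma> k) \<Gamma>"
    using contour_integrable_holomorphic_simple assms \<Gamma>(1)
    by (auto intro!: contour_integral_add)
  then show ?thesis
    by (simp only: cycle_integral_def sum_list_addf distrib_left)
qed

lemma cycle_integral_cmult:
  assumes "open T" "\<And>\<gamma>. \<gamma> \<in> set \<Gamma> \<Longrightarrow> path_image \<gamma> \<subseteq> T" "h holomorphic_on T"
  shows "cycle_integral \<Gamma> (\<lambda>z. c * h z) = c * cycle_integral \<Gamma> h"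
proof -
  have "map (\<lambda>\<gamma>. contour_integral \<gamma> (\<lambda>z. c * h z)) \<Gamma> = map (\<lambda>\<gamma>. c * contour_integral \<gamma> h) \<Gamma>"
    using contour_integrable_holomorphic_simple assms \<Gamma>(1)
    by (auto intro!: contour_integral_lmul)
  then show ?thesis
    by (simp only: cycle_integral_def sum_list_const_mult mult.left_commute)
qed

lemma cycle_integral_cmult_add:
  assumes T: "open T" "\<And>\<gamma>. \<gamma> \<in> set \<Gamma> \<Longrightarrow> path_image \<gamma> \<subseteq> T"
    and h: "h holomorphic_on T" "k holomorphic_on T"
  shows "cycle_integral \<Gamma> (\<lambda>z. c * h z + k z) = c * cycle_integral \<Gamma> h + cycle_integral \<Gamma> k"
proof -
  have "(\<lambda>z. c * h z) holomorphic_on T"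
    by (intro holomorphic_intros h)
  from cycle_integral_add[OF T this h(2)] show ?thesis
    by (simp only: cycle_integral_cmult[OF T h(1)])
qed

lemma cycle_integral_sum:
  assumes "finite I" "open T" "\<And>\<gamma>. \<gamma> \<in> set \<Gamma> \<Longrightarrow> path_image \<gamma> \<subseteq> T"
    and "\<And>i. i \<in> I \<Longrightarrow> h i holomorphic_on T"
  shows "cycle_integral \<Gamma> (\<lambda>z. \<Sum>i\<in>I. h i z) = (\<Sum>i\<in>I. cycle_integral \<Gamma> (h i))"
  using assms(1,4)
proof (induction I rule: finite_induct)
  case empty
  show ?case
    by (simp add: cycle_integral_holomorphic)
next
  case (insert i I)
  then show ?case
    by (simp add: cycle_integral_add[OF assms(2,3)] holomorphic_on_sum)
qed

text \<open>Cauchy's integral formula for a cycle: the difference quotient of \<open>g\<close> at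
  the node extends holomorphically to \<open>S\<close> and integrates to zero, which leaves
  \<open>g (u 0)\<close> times the total index.\<close>

lemma divided_difference_0:
  assumes g: "g holomorphic_on S" and w: "u 0 \<in> index_one"
  shows "divided_difference \<Gamma> g 0 u = g (u 0)"
proof -
  define a where "a = u 0"
  define h where "h z = (if z = a then deriv g a else (g z - g a) / (z - a))" for z
  have h: "h holomorphic_on S"
    unfolding h_def by (rule pole_lemma_open[OF g S])
  let ?T = "S - {a}"
  have T: "open ?T"
    using S by (simp add: open_delete)
  have \<Gamma>T: "path_image \<gamma> \<subseteq> ?T" if "\<gamma> \<in> set \<Gamma>" for \<gamma>
    using w that \<Gamma>(3) by (auto simp: index_one_def a_def)
  have "cycle_integral \<Gamma> (\<lambda>z. g z / (z - a)) = cycle_integral \<Gamma> (\<lambda>z. h z + g a * (1 / (z - a)))"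
    using w by (intro cycle_integral_cong) (auto simp: h_def index_one_def a_def diff_divide_distrib)
  also have "\<dots> = cycle_integral \<Gamma> (\<lambda>z. g a * (1 / (z - a)) + h z)"
    by (simp only: add.commute)
  also have "\<dots> = g a * cycle_integral \<Gamma> (\<lambda>z. 1 / (z - a)) + cycle_integral \<Gamma> h"
    using h by (intro cycle_integral_cmult_add[OF T \<Gamma>T] holomorphic_intros) (auto intro: holomorphic_on_subset)
  also have "cycle_integral \<Gamma> h = 0"
    by (rule cycle_integral_holomorphic[OF h])
  also have "cycle_integral \<Gamma> (\<lambda>z. 1 / (z - a)) = (\<Sum>\<gamma>\<leftarrow>\<Gamma>. winding_number \<gamma> a)"
  proof -
    have "map (\<lambda>\<gamma>. winding_number \<gamma> a) \<Gamma> =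
        map (\<lambda>\<gamma>. 1 / (2 * of_real pi * \<i>) * contour_integral \<gamma> (\<lambda>z. 1 / (z - a))) \<Gamma>"
      using w \<Gamma>(1) by (auto simp: index_one_def a_def winding_number_valid_path)
    then show ?thesis
      by (simp only: cycle_integral_def sum_list_const_mult)
  qed
  also have "\<dots> = 1"
    using w by (simp add: index_one_def a_def)
  finally show ?thesis
    by (simp add: divided_difference_def a_def)
qed

lemma holomorphic_div_prod:
  assumes "g holomorphic_on S"
  shows "(\<lambda>z. g z / (\<Prod>i\<le>m. z - u i)) holomorphic_on (S - u ` {..m::nat})"
proof (rule holomorphic_on_divide)
  show "g holomorphic_on (S - u ` {..m})"
    using assms by (rule holomorphic_on_subset) auto
  show "(\<lambda>z. \<Prod>i\<le>m. z - u i) holomorphic_on (S - u ` {..m})"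
    by (intro holomorphic_intros)
  show "(\<Prod>i\<le>m. z - u i) \<noteq> 0" if "z \<in> S - u ` {..m}" for z
    using that by auto
qed

lemma open_minus_nodes: "open (S - u ` {..m::nat})"
  using S by (intro open_Diff finite_imp_closed) auto

lemma path_image_minus_nodes:
  assumes "\<And>i. i \<le> m \<Longrightarrow> u i \<in> index_one" "\<gamma> \<in> set \<Gamma>"
  shows "path_image \<gamma> \<subseteq> S - u ` {..m}"
  using assms \<Gamma>(3) by (auto simp: index_one_def)

text \<open>With p and q the products without the last and without the first factor, the integrands
  are related by 1 / q - 1 / p = (u (m + 1) - u 0) / (p (z - u (m + 1))).\<close>

lemma divided_difference_recurrence:
  assumes g: "g holomorphic_on S" and u: "\<And>i. i \<le> Suc m \<Longrightarrow> u i \<in> index_one"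
  shows "(u (Suc m) - u 0) * divided_difference \<Gamma> g (Suc m) u =
    divided_difference \<Gamma> g m (u \<circ> Suc) - divided_difference \<Gamma> g m u"
proof -
  let ?T = "S - u ` {..Suc m}"
  note T = open_minus_nodes[of u "Suc m"]
  have \<Gamma>T: "path_image \<gamma> \<subseteq> ?T" if "\<gamma> \<in> set \<Gamma>" for \<gamma>
    by (rule path_image_minus_nodes[OF _ that]) (rule u)
  let ?h = "\<lambda>z. g z / (\<Prod>i\<le>Suc m. z - u i)"
  have hol: "?h holomorphic_on ?T" "(\<lambda>z. g z / (\<Prod>i\<le>m. z - u i)) holomorphic_on ?T"
    by (rule holomorphic_div_prod[OF g])
      (rule holomorphic_on_subset[OF holomorphic_div_prod[OF g]], force)
  have "divided_difference \<Gamma> g m (u \<circ> Suc) =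
      cycle_integral \<Gamma> (\<lambda>z. (u (Suc m) - u 0) * ?h z + g z / (\<Prod>i\<le>m. z - u i))"
    unfolding divided_difference_def
  proof (intro cycle_integral_cong)
    fix \<gamma> z assume "\<gamma> \<in> set \<Gamma>" "z \<in> path_image \<gamma>"
    then have "z \<notin> u ` {..Suc m}"
      using \<Gamma>T by blast
    then have nz: "z - u i \<noteq> 0" if "i \<le> Suc m" for i
      using that by auto
    define p q where "p = (\<Prod>i\<le>m. z - u i)" and "q = (\<Prod>i\<le>m. z - u (Suc i))"
    have p: "p \<noteq> 0" and q: "q \<noteq> 0"
      unfolding p_def q_def using nz by auto
    have pq: "p * (z - u (Suc m)) = (z - u 0) * q"
      unfolding p_def q_def using prod.atMost_Suc_shift[of "\<lambda>i. z - u i" m] by simp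
    have "g z / q = g z * (z - u 0) / ((z - u 0) * q)"
      using nz[of 0] by simp
    also have "\<dots> = g z * (z - u 0) / (p * (z - u (Suc m)))"
      by (simp add: pq)
    also have "\<dots> = (u (Suc m) - u 0) * (g z / (p * (z - u (Suc m)))) + g z / p"
      using nz[of "Suc m"] p by (simp add: field_simps)
    finally show "g z / (\<Prod>i\<le>m. z - (u \<circ> Suc) i) =
        (u (Suc m) - u 0) * ?h z + g z / (\<Prod>i\<le>m. z - u i)"
      by (simp add: p_def q_def)
  qed
  also have "\<dots> = (u (Suc m) - u 0) * divided_difference \<Gamma> g (Suc m) u + divided_difference \<Gamma> g m u"
    unfolding divided_difference_def by (rule cycle_integral_cmult_add[OF T \<Gamma>T hol])
  finally show ?thesis
    by simp
qed

text \<open>All factors except the last are absorbed into a holomorphic numerator, which reduces the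
  claim to a Cauchy-type integral in the moving node.\<close>

lemma divided_difference_continuous:
  assumes g: "g holomorphic_on S" and u: "\<And>i. i \<le> Suc m \<Longrightarrow> u i \<in> index_one"
  shows "((\<lambda>\<mu>. divided_difference \<Gamma> g (Suc m) (u(Suc m := \<mu>))) \<longlongrightarrow>
    divided_difference \<Gamma> g (Suc m) u) (at (u (Suc m)))"
proof -
  let ?G = "\<lambda>z. g z / (\<Prod>i\<le>m. z - u i)"
  have "((\<lambda>\<mu>. contour_integral \<gamma> (\<lambda>z. ?G z / (z - \<mu>))) \<longlongrightarrow>
      contour_integral \<gamma> (\<lambda>z. ?G z / (z - u (Suc m)))) (at (u (Suc m)))" if "\<gamma> \<in> set \<Gamma>" for \<gamma>
  proof (rule tendsto_Cauchy_type_integral[OF open_minus_nodes[of u m] holomorphic_div_prod[OF g]])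
    show "path_image \<gamma> \<subseteq> S - u ` {..m}"
      using u that by (intro path_image_minus_nodes) auto
    show "u (Suc m) \<notin> path_image \<gamma>"
      using u[of "Suc m"] that by (auto simp: index_one_def)
  qed (use that \<Gamma>(1) in auto)
  then have "((\<lambda>\<mu>. \<Sum>i<length \<Gamma>. contour_integral (\<Gamma> ! i) (\<lambda>z. ?G z / (z - \<mu>))) \<longlongrightarrow>
      (\<Sum>i<length \<Gamma>. contour_integral (\<Gamma> ! i) (\<lambda>z. ?G z / (z - u (Suc m))))) (at (u (Suc m)))"
    by (intro tendsto_sum) auto
  then have "((\<lambda>\<mu>. cycle_integral \<Gamma> (\<lambda>z. ?G z / (z - \<mu>))) \<longlongrightarrow>
      cycle_integral \<Gamma> (\<lambda>z. ?G z / (z - u (Suc m)))) (at (u (Suc m)))"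
    unfolding cycle_integral_def sum_list_sum_nth by (intro tendsto_mult_left) (simp add: atLeast0LessThan)
  moreover have "divided_difference \<Gamma> g (Suc m) (u(Suc m := \<mu>)) = cycle_integral \<Gamma> (\<lambda>z. ?G z / (z - \<mu>))" for \<mu>
  proof -
    have "(\<Prod>i\<le>m. z - (u(Suc m := \<mu>)) i) = (\<Prod>i\<le>m. z - u i)" for z
      by (intro prod.cong) auto
    then show ?thesis
      by (simp add: divided_difference_def divide_divide_eq_left)
  qed
  moreover have "divided_difference \<Gamma> g (Suc m) u = cycle_integral \<Gamma> (\<lambda>z. ?G z / (z - u (Suc m)))"
    by (simp add: divided_difference_def divide_divide_eq_left)
  ultimately show ?thesis
    by simp
qed

end

section \<open>The functional calculus\<close>

context locally_bounded_nc
begin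

text \<open>For the nodes z and \<mu> the recurrence identifies the difference quotient with
  \<open>nc_dd\<close> divided by \<epsilon>, which is continuous up to the double node; its value
  there is the derivative.\<close>

lemma fun1_field_differentiable:
  assumes z: "z \<in> level1 V"
  shows "fun1 f field_differentiable (at z)"
proof -
  define u where "u = (\<lambda>_::nat. z)"
  obtain \<epsilon> where \<epsilon>: "\<epsilon> \<noteq> 0" "newton_bidiag 1 u \<epsilon> \<in> V"
  proof -
    have "\<forall>\<^sub>F \<epsilon> in at 0. newton_bidiag 1 u \<epsilon> \<in> V \<and> \<epsilon> \<noteq> 0"
      using z by (intro eventually_conj eventually_newton_bidiag_in eventually_neq_at_within) (auto simp: u_def)
    then show ?thesis
      using that eventually_happens'[OF at_neq_bot] by blast
  qed
  have "\<forall>\<^sub>F \<mu> in at z. newton_bidiag 1 (u(1 := \<mu>)) \<epsilon> \<in> V"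
    using eventually_freely_open[OF tends_newton_bidiag_upd[of 1 u 1] open_V \<epsilon>(2)] by (simp add: u_def)
  moreover have "\<forall>\<^sub>F \<mu> in at z. \<mu> \<in> level1 V"
    using z open_level1[OF open_V] by (rule eventually_at_in_open'[rotated])
  moreover have "\<forall>\<^sub>F \<mu> in at z. \<mu> \<noteq> z"
    by (rule eventually_neq_at_within)
  ultimately have "\<forall>\<^sub>F \<mu> in at z. nc_dd 1 (u(1 := \<mu>)) \<epsilon> / \<epsilon> = (fun1 f \<mu> - fun1 f z) / (\<mu> - z)"
  proof eventually_elim
    case (elim \<mu>)
    have "(\<mu> - z) * nc_dd 1 (u(1 := \<mu>)) \<epsilon> = \<epsilon> * (fun1 f \<mu> - fun1 f z)"
      using nc_dd_recurrence[of 0 "u(1 := \<mu>)" \<epsilon>] elim z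
      by (simp add: nc_dd_0 newton_bidiag_0 level1_def u_def)
    then show ?case
      using elim \<epsilon>(1) by (simp add: field_simps)
  qed
  moreover have "((\<lambda>\<mu>. nc_dd 1 (u(1 := \<mu>)) \<epsilon> / \<epsilon>) \<longlongrightarrow> nc_dd 1 u \<epsilon> / \<epsilon>) (at z)"
    using nc_dd_continuous[OF \<epsilon>(2), of 1] \<epsilon>(1) by (intro tendsto_divide tendsto_const) (auto simp: u_def)
  ultimately have "((\<lambda>\<mu>. (fun1 f \<mu> - fun1 f z) / (\<mu> - z)) \<longlongrightarrow> nc_dd 1 u \<epsilon> / \<epsilon>) (at z)"
    by (rule Lim_transform_eventually[rotated])
  then show ?thesis
    by (auto simp: field_differentiable_def has_field_derivative_iff)
qed

end

text \<open>\<open>V\<close> is a neighbourhood of a single point, whereas \<open>S\<close> is the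
  region that carries the cycle; in the end \<open>S\<close> is \<open>level1 U\<close>, which may
  be larger than \<open>level1 V\<close>.\<close>

locale locally_bounded_nc_cycle = locally_bounded_nc V f + null_homologous_cycle \<Gamma> S
  for V f \<Gamma> S +
  assumes fun1_holomorphic: "fun1 f holomorphic_on S"
begin

text \<open>For distinct end nodes both sides obey the same recurrence; for equal end nodes move the last
  one and pass to the limit.\<close>

lemma nc_dd_eq_divided_difference:
  assumes "\<And>i. i \<le> m \<Longrightarrow> u i \<in> level1 V \<inter> index_one"
    and "\<epsilon> \<noteq> 0" "newton_bidiag m u \<epsilon> \<in> V"
  shows "nc_dd m u \<epsilon> = \<epsilon> ^ m * divided_difference \<Gamma> (fun1 f) m u"
  using assms
proof (induction m arbitrary: u \<epsilon>)
  case 0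
  then show ?case
    using divided_difference_0[OF fun1_holomorphic, of u] by (simp add: nc_dd_0)
next
  case (Suc m)
  have distinct: "nc_dd (Suc m) u \<epsilon> = \<epsilon> ^ Suc m * divided_difference \<Gamma> (fun1 f) (Suc m) u"
    if u: "\<And>i. i \<le> Suc m \<Longrightarrow> u i \<in> level1 V \<inter> index_one" and ne: "u (Suc m) \<noteq> u 0"
      and \<epsilon>: "\<epsilon> \<noteq> 0" "newton_bidiag (Suc m) u \<epsilon> \<in> V" for u \<epsilon>
  proof -
    \<comment> \<open>Nothing places the shorter matrices with parameter \<open>\<epsilon>\<close>
      in \<open>V\<close>, so the recurrence is used with a small \<open>\<eta>\<close>, and
      \<open>nc_dd_rescale\<close> leads back to \<open>\<epsilon>\<close>.\<close>
    have "\<forall>\<^sub>F \<eta> in at 0. newton_bidiag (Suc m) u \<eta> \<in> V \<and> newton_bidiag m (u \<circ> Suc) \<eta> \<in> V \<and>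
        newton_bidiag m u \<eta> \<in> V \<and> \<eta> \<noteq> 0"
      using u by (intro eventually_conj eventually_newton_bidiag_in eventually_neq_at_within) auto
    then obtain \<eta> where \<eta>: "newton_bidiag (Suc m) u \<eta> \<in> V" "newton_bidiag m (u \<circ> Suc) \<eta> \<in> V"
        "newton_bidiag m u \<eta> \<in> V" "\<eta> \<noteq> 0"
      using eventually_happens'[OF at_neq_bot] by blast
    have IH: "nc_dd m (u \<circ> Suc) \<eta> = \<eta> ^ m * divided_difference \<Gamma> (fun1 f) m (u \<circ> Suc)"
        "nc_dd m u \<eta> = \<eta> ^ m * divided_difference \<Gamma> (fun1 f) m u"
      using u \<eta> by (auto intro!: Suc.IH)
    have "(u (Suc m) - u 0) * nc_dd (Suc m) u \<eta> = \<eta> ^ Suc m *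
        (divided_difference \<Gamma> (fun1 f) m (u \<circ> Suc) - divided_difference \<Gamma> (fun1 f) m u)"
      unfolding nc_dd_recurrence[OF \<eta>(1-3)] IH by (simp add: algebra_simps)
    also have "\<dots> = (u (Suc m) - u 0) * (\<eta> ^ Suc m * divided_difference \<Gamma> (fun1 f) (Suc m) u)"
      using u by (subst divided_difference_recurrence[OF fun1_holomorphic, symmetric]) auto
    finally have "nc_dd (Suc m) u \<eta> = \<eta> ^ Suc m * divided_difference \<Gamma> (fun1 f) (Suc m) u"
      using ne by simp
    then show ?thesis
      unfolding nc_dd_rescale[OF \<epsilon>(2) \<eta>(1,4)] using \<eta>(4) by (simp add: power_divide)
  qed
  show ?case
  proof (cases "u (Suc m) = u 0")
    case False
    then show ?thesis
      using distinct Suc.prems by blast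
  next
    case True
    let ?z = "u (Suc m)" and ?v = "\<lambda>\<mu>. u(Suc m := \<mu>)"
    have z: "?z \<in> level1 V \<inter> index_one"
      using Suc.prems(1) by simp
    have op: "open (level1 V \<inter> index_one)"
      using open_level1[OF open_V] open_index_one by (rule open_Int)
    \<comment> \<open>Only the last node moves and \<open>\<epsilon>\<close> is kept: by openness
      the perturbed matrix stays in \<open>V\<close>, where the case of distinct end nodes
      applies.\<close>
    have "\<forall>\<^sub>F \<mu> in at ?z. newton_bidiag (Suc m) (?v \<mu>) \<epsilon> \<in> V"
      by (rule eventually_freely_open[OF tends_newton_bidiag_upd open_V Suc.prems(3)])
    moreover have "\<forall>\<^sub>F \<mu> in at ?z. \<mu> \<in> level1 V \<inter> index_one"
      using op z by (rule eventually_at_in_open')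
    moreover have "\<forall>\<^sub>F \<mu> in at ?z. \<mu> \<noteq> ?z"
      by (rule eventually_neq_at_within)
    ultimately have "\<forall>\<^sub>F \<mu> in at ?z. \<epsilon> ^ Suc m * divided_difference \<Gamma> (fun1 f) (Suc m) (?v \<mu>) =
        nc_dd (Suc m) (?v \<mu>) \<epsilon>"
    proof eventually_elim
      case (elim \<mu>)
      then show ?case
        using True Suc.prems by (intro distinct[symmetric]) (auto simp: le_Suc_eq)
    qed
    moreover have "((\<lambda>\<mu>. \<epsilon> ^ Suc m * divided_difference \<Gamma> (fun1 f) (Suc m) (?v \<mu>)) \<longlongrightarrow>
        \<epsilon> ^ Suc m * divided_difference \<Gamma> (fun1 f) (Suc m) u) (at ?z)"
      using Suc.prems(1) by (intro tendsto_mult_left divided_difference_continuous[OF fun1_holomorphic]) auto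
    ultimately have "((\<lambda>\<mu>. nc_dd (Suc m) (?v \<mu>) \<epsilon>) \<longlongrightarrow>
        \<epsilon> ^ Suc m * divided_difference \<Gamma> (fun1 f) (Suc m) u) (at ?z)"
      by (rule Lim_transform_eventually[rotated])
    moreover have "((\<lambda>\<mu>. nc_dd (Suc m) (?v \<mu>) \<epsilon>) \<longlongrightarrow> nc_dd (Suc m) u \<epsilon>) (at ?z)"
      by (rule nc_dd_continuous[OF Suc.prems(3)])
    ultimately show ?thesis
      using tendsto_unique[OF at_neq_bot] by blast
  qed
qed

lemma f_eq_divided_difference_expansion:
  assumes x: "x \<in> V" "x \<in> carrier_mat n n" and P: "newton_mat x u (Suc m) = 0\<^sub>m n n"
    and u: "\<And>i. i \<le> m \<Longrightarrow> u i \<in> level1 V \<inter> index_one" and ik: "i < n" "k < n"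
  shows "f x $$ (i, k) = (\<Sum>j\<le>m. divided_difference \<Gamma> (fun1 f) j u * newton_mat x u j $$ (i, k))"
proof -
  have "\<forall>\<^sub>F \<epsilon> in at 0. (\<forall>j\<in>{..m}. newton_bidiag j u \<epsilon> \<in> V) \<and> \<epsilon> \<noteq> 0"
    using u by (intro eventually_conj eventually_ball_finite ballI eventually_newton_bidiag_in
        eventually_neq_at_within) auto
  then obtain \<epsilon> where \<epsilon>: "\<And>j. j \<le> m \<Longrightarrow> newton_bidiag j u \<epsilon> \<in> V" "\<epsilon> \<noteq> 0"
    using eventually_happens'[OF at_neq_bot] by blast
  have "nc_dd j u \<epsilon> / \<epsilon> ^ j = divided_difference \<Gamma> (fun1 f) j u" if "j \<le> m" for j
    using nc_dd_eq_divided_difference[of j u \<epsilon>] u \<epsilon> that by simp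
  then show ?thesis
    using f_newton_expansion[OF x P \<epsilon>(2,1) ik] by simp
qed

lemma f_eq_riesz_integral:
  assumes x: "x \<in> V" "x \<in> carrier_mat n n" and P: "newton_mat x u (Suc m) = 0\<^sub>m n n"
    and u: "\<And>i. i \<le> m \<Longrightarrow> u i \<in> level1 V \<inter> index_one"
  shows "f x = riesz_integral \<Gamma> (fun1 f) x"
proof (rule eq_matI)
  fix a b assume "a < dim_row (riesz_integral \<Gamma> (fun1 f) x)" "b < dim_col (riesz_integral \<Gamma> (fun1 f) x)"
  then have ab: "a < n" "b < n"
    using x by (auto simp: riesz_integral_def)
  let ?T = "S - u ` {..m}"
  have u1: "u i \<in> index_one" if "i \<le> m" for i
    using u[OF that] by simp
  note T = open_minus_nodes[of u m]
  have \<Gamma>T: "path_image \<gamma> \<subseteq> ?T" if "\<gamma> \<in> set \<Gamma>" for \<gamma>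
    by (rule path_image_minus_nodes[OF u1 that])
  have hol: "(\<lambda>z. fun1 f z / (\<Prod>i\<le>j. z - u i)) holomorphic_on ?T" if "j \<le> m" for j
    by (rule holomorphic_on_subset[OF holomorphic_div_prod[OF fun1_holomorphic]]) (use that in force)
  have "riesz_integral \<Gamma> (fun1 f) x $$ (a, b) = cycle_integral \<Gamma> (\<lambda>z. fun1 f z * resolvent x z $$ (a, b))"
    using ab x by (simp add: riesz_integral_def cycle_integral_def)
  \<comment> \<open>The expansion of the resolvent is available off the nodes, and the nodes, being
    in \<open>index_one\<close>, are off the cycle.\<close>
  also have "\<dots> = cycle_integral \<Gamma> (\<lambda>z. \<Sum>j\<le>m. newton_mat x u j $$ (a, b) * (fun1 f z / (\<Prod>i\<le>j. z - u i)))"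
  proof (rule cycle_integral_cong)
    fix \<gamma> z assume "\<gamma> \<in> set \<Gamma>" "z \<in> path_image \<gamma>"
    then have "z \<notin> u ` {..m}"
      using \<Gamma>T by blast
    then have "z \<noteq> u i" if "i \<le> m" for i
      using that by auto
    then show "fun1 f z * resolvent x z $$ (a, b) =
        (\<Sum>j\<le>m. newton_mat x u j $$ (a, b) * (fun1 f z / (\<Prod>i\<le>j. z - u i)))"
      by (simp add: resolvent_newton[OF x(2) P _ ab] sum_distrib_left mult_ac)
  qed
  also have "\<dots> = (\<Sum>j\<le>m. cycle_integral \<Gamma> (\<lambda>z. newton_mat x u j $$ (a, b) * (fun1 f z / (\<Prod>i\<le>j. z - u i))))"
    using hol by (intro cycle_integral_sum[OF _ T \<Gamma>T] holomorphic_on_mult holomorphic_on_const) auto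
  also have "\<dots> = (\<Sum>j\<le>m. divided_difference \<Gamma> (fun1 f) j u * newton_mat x u j $$ (a, b))"
    unfolding divided_difference_def using hol
    by (intro sum.cong refl) (subst cycle_integral_cmult[OF T \<Gamma>T], auto)
  also have "\<dots> = f x $$ (a, b)"
    using f_eq_divided_difference_expansion[OF x P u ab] by simp
  finally show "f x $$ (a, b) = riesz_integral \<Gamma> (fun1 f) x $$ (a, b)"
    by simp
qed (use graded[OF x] x in \<open>auto simp: riesz_integral_def\<close>)

end

section \<open>Membership in the generated algebra and the conclusion\<close>

lemma newton_mat_in_generated_matrix_algebra:
  assumes x: "x \<in> carrier_mat n n"
  shows "newton_mat x u j \<in> generated_matrix_algebra n {x, 1\<^sub>m n}"
proof (induction j)
  case 0
  then show ?case
    using x by (simp add: generated_matrix_algebra.generator)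
next
  case (Suc j)
  have "x - u j \<cdot>\<^sub>m 1\<^sub>m n = x + (- u j) \<cdot>\<^sub>m 1\<^sub>m n"
    using x by (intro eq_matI) auto
  then have "x - u j \<cdot>\<^sub>m 1\<^sub>m n \<in> generated_matrix_algebra n {x, 1\<^sub>m n}"
    by (simp add: generated_matrix_algebra.generator generated_matrix_algebra.add generated_matrix_algebra.scale)
  then show ?case
    using Suc x by (simp add: generated_matrix_algebra.mult)
qed

lemma newton_combination_in_generated_matrix_algebra:
  assumes x: "x \<in> carrier_mat n n"
  shows "mat n n (\<lambda>(a, b). \<Sum>j<m. c j * newton_mat x u j $$ (a, b)) \<in> generated_matrix_algebra n {x, 1\<^sub>m n}"
proof (induction m)
  case 0
  have "mat n n (\<lambda>(a, b). \<Sum>j<0. c j * newton_mat x u j $$ (a, b)) = 0\<^sub>m n n"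
    by auto
  then show ?case
    by (simp only: generated_matrix_algebra.zero)
next
  case (Suc m)
  have "mat n n (\<lambda>(a, b). \<Sum>j<Suc m. c j * newton_mat x u j $$ (a, b)) =
      mat n n (\<lambda>(a, b). \<Sum>j<m. c j * newton_mat x u j $$ (a, b)) + c m \<cdot>\<^sub>m newton_mat x u m"
    using newton_mat_carrier[OF x, of u m] by (intro eq_matI) auto
  then show ?case
    using Suc newton_mat_in_generated_matrix_algebra[OF x]
    by (simp only: generated_matrix_algebra.add generated_matrix_algebra.scale)
qed

lemma freely_holomorphic_locally_bounded_nc:
  assumes f: "freely_holomorphic_on U f" and x: "x \<in> U"
  obtains V where "x \<in> V" "V \<subseteq> U" "locally_bounded_nc V f"
proof -
  obtain V where V: "freely_open V" "x \<in> V" "V \<subseteq> U" "nc_function_on V f"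
    using f x unfolding freely_holomorphic_on_def by blast
  have "locally_bounded_nc V f"
    using V f unfolding freely_holomorphic_on_def by unfold_locales blast+
  then show ?thesis
    using that V by blast
qed

theorem proposition5p13:
  fixes U :: "complex mat set" and f :: "complex mat \<Rightarrow> complex mat"
  assumes "freely_open U"
    and "freely_holomorphic_on U f"
  shows "\<forall>x\<in>U. f x = riesz_calculus (level1 U) (fun1 f) x
    \<and> f x \<in> generated_matrix_algebra (dim_row x) {x, 1\<^sub>m (dim_row x)}"
proof
  fix x assume xU: "x \<in> U"
  obtain V where V: "x \<in> V" "V \<subseteq> U" "locally_bounded_nc V f"
    using freely_holomorphic_locally_bounded_nc[OF assms(2) xU] by blast
  interpret locally_bounded_nc V f
    by (rule V(3))
  obtain n where x: "x \<in> carrier_mat n n"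
    using V(1) freely_open_subset_nc_universe[OF open_V] by (auto simp: nc_universe_def)
  obtain m where m: "n = Suc m"
    using dim_pos[OF V(1) x] by (cases n) auto
  let ?S = "level1 U"
  \<comment> \<open>The same choice as in the definition of \<open>riesz_calculus\<close>; only its
    property \<open>surrounds_in\<close> is used.\<close>
  define \<Gamma> where "\<Gamma> = (SOME \<Gamma>. surrounds_in \<Gamma> (spectrum x) ?S)"
  have "\<exists>\<Gamma>. surrounds_in \<Gamma> (spectrum x) ?S"
    using card_finite_spectrum(1)[OF x] open_level1[OF assms(1)] spectrum_subset_level1[OF assms(1) xU]
    by (rule surrounds_in_exists)
  then have sur: "surrounds_in \<Gamma> (spectrum x) ?S"
    unfolding \<Gamma>_def by (rule someI_ex)
  \<comment> \<open>The cycle may leave \<open>level1 V\<close>, so holomorphy is wanted on all of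
    \<open>level1 U\<close>; being a local property, it follows from a separate neighbourhood
    \<open>W\<close> at each point.\<close>
  have "fun1 f holomorphic_on ?S"
    unfolding holomorphic_on_def
  proof
    fix z assume "z \<in> ?S"
    then have "scalar_mat z \<in> U"
      by (simp add: level1_def)
    from freely_holomorphic_locally_bounded_nc[OF assms(2) this]
    obtain W where W: "scalar_mat z \<in> W" "locally_bounded_nc W f" .
    then have "fun1 f field_differentiable (at z)"
      by (intro locally_bounded_nc.fun1_field_differentiable[OF W(2)]) (simp add: level1_def)
    then show "fun1 f field_differentiable (at z within ?S)"
      by (rule field_differentiable_at_within)
  qed
  then interpret locally_bounded_nc_cycle V f \<Gamma> ?S
    using sur open_level1[OF assms(1)] by unfold_locales (auto simp: surrounds_in_def)
  obtain u where u: "\<And>i. i < n \<Longrightarrow> u i \<in> spectrum x" "newton_mat x u n = 0\<^sub>m n n"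
    using newton_mat_spectrum_eq_zero[OF x] by blast
  \<comment> \<open>The nodes must lie in \<open>level1 V\<close>, not just in
    \<open>level1 U\<close>, so that small bidiagonal perturbations of their diagonal matrix lie in
    \<open>V\<close>; this holds because \<open>V\<close> itself is freely open.\<close>
  have nodes: "u i \<in> level1 V \<inter> index_one" if "i \<le> m" for i
    using u(1)[of i] that m spectrum_subset_level1[OF open_V V(1)] sur
    by (auto simp: surrounds_in_def index_one_def)
  note P = u(2)[unfolded m]
  have "f x = riesz_integral \<Gamma> (fun1 f) x"
    using f_eq_riesz_integral[OF V(1) x _ nodes] P m by simp
  moreover have "f x = mat n n (\<lambda>(a, b). \<Sum>j<Suc m. divided_difference \<Gamma> (fun1 f) j u * newton_mat x u j $$ (a, b))"
    using f_eq_divided_difference_expansion[OF V(1) x _ nodes] P m graded[OF V(1) x]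
    by (intro eq_matI) (auto simp: lessThan_Suc_atMost)
  then have "f x \<in> generated_matrix_algebra n {x, 1\<^sub>m n}"
    using newton_combination_in_generated_matrix_algebra[OF x] by (simp only:)
  ultimately show "f x = riesz_calculus ?S (fun1 f) x
    \<and> f x \<in> generated_matrix_algebra (dim_row x) {x, 1\<^sub>m (dim_row x)}"
    using x by (simp add: riesz_calculus_def \<Gamma>_def)
qed

end
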